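(* Let $n$ be a positive integer and let $k,m,a,t$ be complex numbers such that all the functions below are defined. Then $$\sum _{r=0}^{n-1} e^{-\frac{i \pi m r}{n}} \left((-1)^m\, \Phi \left(e^{i m \pi },-k,a-\frac{2 \pi r+t}{2 n \pi }+1\right)+e^{\frac{i m (2 \pi r+t)}{n}}\, \Phi \left(e^{i m \pi },-k,a+\frac{2 \pi r+t}{2 n \pi }\right)\right)$$ $$=n^{-k} \left(e^{\frac{i \pi m}{n}}\, \Phi \left(e^{\frac{i m \pi }{n}},-k,a n-\frac{t}{2 \pi }+1\right)+e^{\frac{i m t}{n}}\, \Phi \left(e^{\frac{i m \pi }{n}},-k,a n+\frac{t}{2 \pi }\right)\right).$$
   Context: $\Phi(z,s,v)$ is the Hurwitz–Lerch zeta function: $\Phi(z,s,v)=\sum_{j=0}^{\infty}\frac{z^j}{(j+v)^s}$ for $v\notin\{0,-1,-2,\dots\}$ and $|z|<1$ (or $|z|=1$, $\operatorname{Re}s>1$), and by analytic continuation (principal branch, cut along $z\in[1,\infty)$) for other values; $\Phi(1,s,v)$ is the Hurwitz zeta function $\zeta(s,v)$. Powers are principal values; in particular $(-1)^{m}=e^{\pi i m}$. *)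

theory Defs
  imports "HOL-Complex_Analysis.Complex_Analysis"
begin

text \<open>Value at \<open>x\<close> of the holomorphic continuation to \<open>V\<close> of a function given on \<open>U\<close>.
  It is only meaningful if \<open>V\<close> is connected and open, \<open>U \<subseteq> V\<close> has nonempty interior, and a
  continuation exists; see \<open>continuation_eqI\<close>.\<close>

definition continuation ::
    "(complex \<Rightarrow> complex) \<Rightarrow> complex set \<Rightarrow> complex set \<Rightarrow> complex \<Rightarrow> complex" where
  "continuation f U V x =
     (THE w. \<exists>g. g holomorphic_on V \<and> (\<forall>u\<in>U. g u = f u) \<and> w = g x)"

lemma continuation_eqI:
  assumes "open V" "connected V" "open U" "U \<noteq> {}" "U \<subseteq> V" "x \<in> V"
    and g: "g holomorphic_on V" "\<And>u. u \<in> U \<Longrightarrow> g u = f u"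
  shows "continuation f U V x = g x"
  unfolding continuation_def
proof (rule the_equality)
  show "\<exists>h. h holomorphic_on V \<and> (\<forall>u\<in>U. h u = f u) \<and> g x = h x"
    using g by blast
next
  fix w
  assume "\<exists>h. h holomorphic_on V \<and> (\<forall>u\<in>U. h u = f u) \<and> w = h x"
  then obtain h where h: "h holomorphic_on V" "\<forall>u\<in>U. h u = f u" "w = h x" by blast
  have "h x = g x"
    by (rule analytic_continuation_open[of U V h g]) (use assms h in auto)
  with h show "w = g x" by simp
qed

definition lerch_series :: "complex \<Rightarrow> complex \<Rightarrow> complex \<Rightarrow> complex" where
  "lerch_series z s v = (\<Sum>j. z ^ j / (of_nat j + v) powr s)"

text \<open>The Hurwitz zeta function is continued in \<open>s\<close> from \<open>Re s > 1\<close>.\<close>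

definition hurwitz_zeta :: "complex \<Rightarrow> complex \<Rightarrow> complex" where
  "hurwitz_zeta s v = continuation (\<lambda>u. lerch_series 1 u v) {u. Re u > 1} (- {1}) s"

text \<open>The principal branch is obtained, for fixed \<open>s\<close> and \<open>v\<close>, by continuation in \<open>z\<close> from
  the unit disc to the plane cut along \<open>[1,\<infinity>)\<close>. The end point \<open>z = 1\<close> of the cut carries the
  Hurwitz zeta function.\<close>

definition lerch_phi :: "complex \<Rightarrow> complex \<Rightarrow> complex \<Rightarrow> complex" where
  "lerch_phi z s v =
     (if norm z < 1 \<or> (norm z = 1 \<and> Re s > 1) then lerch_series z s v
      else if z = 1 then hurwitz_zeta s v
      else continuation (\<lambda>u. lerch_series u s v) (ball 0 1) (- complex_of_real ` {1..}) z)"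

text \<open>The arguments at which the principal branch is defined: \<open>z\<close> is not in the interior
  \<open>(1,\<infinity>)\<close> of the cut, and \<open>s\<close> is not the pole of the Hurwitz zeta function if \<open>z = 1\<close>.\<close>

definition lerch_defined :: "complex \<Rightarrow> complex \<Rightarrow> complex \<Rightarrow> bool" where
  "lerch_defined z s v \<longleftrightarrow>
     v \<notin> \<int>\<^sub>\<le>\<^sub>0 \<and> z \<notin> complex_of_real ` {1<..} \<and> (z = 1 \<longrightarrow> s \<noteq> 1)"

end

theory Submission
  imports Defs "HOL-Real_Asymp.Real_Asymp"
begin

text \<open>
  Put \<open>w = exp (\<i> * pi * m / n)\<close>, so that \<open>w ^ n = exp (\<i> * pi * m) = (-1) powr m\<close>. After collecting
  exponentials, both halves of the sum are instances of the multiplication formula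
  \<open>\<Phi>(w, s, v) = n powr (-s) * (\<Sum>r<n. w ^ r * \<Phi>(w ^ n, s, (v + r) / n))\<close>
  (\<open>lerch_phi_multiplication\<close>) at \<open>s = -k\<close>: the terms with \<open>a + (2 * pi * r + t) / (2 * n * pi)\<close> belong
  to \<open>v = a * n + t / (2 * pi)\<close>, and those with \<open>a - (2 * pi * r + t) / (2 * n * pi) + 1\<close>, read in the
  order \<open>r \<mapsto> n - 1 - r\<close>, belong to \<open>v = a * n - t / (2 * pi) + 1\<close>.

  Where the series converge, the multiplication formula is the decomposition of the summation
  index into residue classes modulo \<open>n\<close> (\<open>lerch_series_multiplication\<close>). For the principal branch
  it is transported by analytic continuation. The set of all \<open>w\<close> for which \<open>w ^ n\<close> avoids the cut
  is star-shaped about 0 (\<open>power_slit_plane_domain\<close>), so continuation in \<open>w\<close> from the unit disc is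
  unambiguous. At the end point of the cut, \<open>w ^ n = 1\<close>, the terms on the right are Hurwitz zeta
  values, and the identity is continued in \<open>s\<close> from \<open>Re s > 1\<close> instead.

  Both steps presuppose that the continuations exist and depend holomorphically on the right
  variable. Off the cut a Mellin integral represents the Lerch function simultaneously in \<open>z\<close>
  and \<open>s\<close> (\<open>lerch_phi_eq_continuation\<close>), which makes it holomorphic in \<open>z\<close> and entire in \<open>s\<close>. For
  \<open>z = 1\<close> a Taylor expansion under a telescoping sum expresses \<open>(s - 1) * \<zeta>(s, v)\<close> through the values
  \<open>\<zeta>(s + l, v)\<close> and a series converging further to the left (\<open>hurwitz_recurrence\<close>), which continues
  it to one half-plane after another.
\<close>

section \<open>Holomorphic dependence of series and integrals on a parameter\<close>

lemma holomorphic_suminf: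
  fixes f :: "nat \<Rightarrow> complex \<Rightarrow> complex"
  assumes S: "open S" and hol: "\<And>j. f j holomorphic_on S"
    and bound: "\<And>x. x \<in> S \<Longrightarrow> \<exists>d>0. \<exists>M. summable M \<and>
                  (\<forall>\<^sub>F j in sequentially. \<forall>y\<in>ball x d \<inter> S. norm (f j y) \<le> M j)"
  shows "(\<lambda>x. \<Sum>j. f j x) holomorphic_on S" and "\<And>x. x \<in> S \<Longrightarrow> summable (\<lambda>j. f j x)"
proof -
  have "\<exists>d (h :: nat \<Rightarrow> complex). 0 < d \<and> summable h \<and> range h \<subseteq> \<real>\<^sub>\<ge>\<^sub>0 \<and>
          (\<forall>\<^sub>F j in sequentially. \<forall>y\<in>ball x d \<inter> S. norm (f j y) \<le> norm (h j))"
    if x: "x \<in> S" for x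
  proof -
    obtain d M where dM: "d > 0" "summable M"
        "\<forall>\<^sub>F j in sequentially. \<forall>y\<in>ball x d \<inter> S. norm (f j y) \<le> M j"
      using bound[OF x] by blast
    have nonneg: "\<forall>\<^sub>F j in sequentially. M j \<ge> 0"
      using dM(3) by eventually_elim (use x dM(1) in \<open>force intro: order_trans[OF norm_ge_zero]\<close>)
    have "summable (\<lambda>j. \<bar>M j\<bar>)"
      using dM(2) nonneg by (subst summable_cong[of _ M]) (auto elim!: eventually_mono)
    moreover have "\<forall>\<^sub>F j in sequentially. \<forall>y\<in>ball x d \<inter> S.
        norm (f j y) \<le> norm (complex_of_real \<bar>M j\<bar>)"
      using dM(3) by eventually_elim force
    ultimately have "0 < d \<and> summable (\<lambda>j. complex_of_real \<bar>M j\<bar>) \<and>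
        range (\<lambda>j. complex_of_real \<bar>M j\<bar>) \<subseteq> \<real>\<^sub>\<ge>\<^sub>0 \<and> (\<forall>\<^sub>F j in sequentially. \<forall>y\<in>ball x d \<inter> S.
        norm (f j y) \<le> norm (complex_of_real \<bar>M j\<bar>))"
      using dM(1) by (intro conjI summable_of_real) auto
    thus ?thesis
      by (intro exI[of _ d] exI[of _ "\<lambda>j. complex_of_real \<bar>M j\<bar>"])
  qed
  note dominated = this
  have diff: "f j field_differentiable (at x)" if "x \<in> S" for j x
    using holomorphic_on_imp_differentiable_at[OF hol S that] .
  obtain g where g: "\<forall>x\<in>S. (\<lambda>j. f j x) sums g x \<and> g field_differentiable (at x)"
  proof (rule series_differentiable_comparison_complex[OF S])
    show "f j field_differentiable (at x)" if "x \<in> S" for j x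
      by (rule diff[OF that])
  qed (use dominated in auto)
  show "summable (\<lambda>j. f j x)" if "x \<in> S" for x
    using g that sums_summable by blast
  have "g holomorphic_on S"
    using g by (auto simp: holomorphic_on_def intro: field_differentiable_at_within)
  thus "(\<lambda>x. \<Sum>j. f j x) holomorphic_on S"
    by (rule holomorphic_transform) (use g sums_unique in blast)
qed

text \<open>The derivative can be taken under the integral: on a slightly smaller disc the Cauchy
  inequality turns the dominating function \<open>h\<close> of the integrand into a dominating function
  \<open>h / r\<close> of its difference quotients, so that dominated convergence applies. Dominated
  convergence also copes with the integrands below, which may be singular at 0.\<close>

lemma holomorphic_integral:
  fixes f :: "complex \<Rightarrow> 'a \<Rightarrow> complex"
  assumes S: "open S" and hol: "\<And>t. t \<in> space M \<Longrightarrow> (\<lambda>w. f w t) holomorphic_on S"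
    and meas: "\<And>w. w \<in> S \<Longrightarrow> f w \<in> borel_measurable M"
    and bound: "\<And>w. w \<in> S \<Longrightarrow> \<exists>d>0. \<exists>h. integrable M h \<and>
                  (\<forall>x\<in>ball w d \<inter> S. \<forall>t\<in>space M. norm (f x t) \<le> h t)"
  shows "(\<lambda>w. \<integral>t. f w t \<partial>M) holomorphic_on S"
proof -
  have int: "integrable M (f w)" if "w \<in> S" for w
  proof -
    obtain d h where "d > 0" "integrable M h" "\<forall>x\<in>ball w d \<inter> S. \<forall>t\<in>space M. norm (f x t) \<le> h t"
      using bound[OF \<open>w \<in> S\<close>] by blast
    thus ?thesis using that
      by (intro Bochner_Integration.integrable_bound[OF \<open>integrable M h\<close> meas])
         (auto intro!: AE_I2 order_trans[OF _ abs_ge_self])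
  qed
  have "\<exists>D. ((\<lambda>w. \<integral>t. f w t \<partial>M) has_field_derivative D) (at w)" if w: "w \<in> S" for w
  proof -
    obtain d h where d: "d > 0" and h: "integrable M h"
        and le: "\<And>x t. x \<in> ball w d \<inter> S \<Longrightarrow> t \<in> space M \<Longrightarrow> norm (f x t) \<le> h t"
      using bound[OF w] by blast
    obtain d' where d': "d' > 0" "ball w d' \<subseteq> S"
      using S w by (meson open_contains_ball)
    \<comment> \<open>A third of the radius: discs of radius \<open>r\<close> about points of \<open>cball w r\<close> stay inside both balls.\<close>
    define r where "r = min d d' / 3"
    have r: "r > 0" "cball w (2*r) \<subseteq> ball w d \<inter> S"
      using d d' by (auto simp: r_def min_def subset_iff)
    have der: "((\<lambda>w. f w t) has_field_derivative deriv (\<lambda>w. f w t) x) (at x)"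
      if "x \<in> S" "t \<in> space M" for x t
      using hol S that by (metis holomorphic_derivI)
    have dbound: "norm (deriv (\<lambda>w. f w t) x) \<le> h t / r" if x: "x \<in> cball w r" and t: "t \<in> space M" for x t
    proof -
      have sub: "cball x r \<subseteq> ball w d \<inter> S"
      proof -
        have "cball x r \<subseteq> cball w (2*r)"
          using x by (auto simp: subset_iff) (smt (verit) dist_triangle)
        thus ?thesis using r by blast
      qed
      have "norm ((deriv ^^ 1) (\<lambda>w. f w t) x) \<le> fact 1 * h t / r ^ 1"
        by (rule Cauchy_inequality)
           (use sub r t hol[OF t] le in \<open>auto intro!: holomorphic_on_imp_continuous_on
               intro: holomorphic_on_subset simp: subset_iff dist_norm\<close>)
      thus ?thesis by simp
    qed
    define q where "q = (\<lambda>x t. (f x t - f w t) / (x - w))"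
    have qbound: "norm (q x t) \<le> h t / r" if x: "x \<in> cball w r" "x \<noteq> w" and t: "t \<in> space M" for x t
    proof -
      have "norm (f x t - f w t) \<le> h t / r * norm (x - w)"
        by (rule field_differentiable_bound[of "cball w r" "\<lambda>w. f w t"])
           (use x r t dbound in \<open>auto intro!: has_field_derivative_at_within[OF der] simp: subset_iff\<close>)
      thus ?thesis using x r by (simp add: q_def norm_divide divide_simps)
    qed
    have "((\<lambda>x. \<integral>t. q x t \<partial>M) \<longlongrightarrow> (\<integral>t. deriv (\<lambda>w. f w t) w \<partial>M)) (at w within cball w r)"
      unfolding tendsto_at_iff_sequentially comp_def
    proof (intro allI impI)
      fix X :: "nat \<Rightarrow> complex" assume X: "\<forall>i. X i \<in> cball w r - {w}" "X \<longlonglongrightarrow> w"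
      have XS: "X i \<in> S" for i
        using X(1)[rule_format, of i] r by (auto simp: subset_iff)
      have lim: "(\<lambda>i. q (X i) t) \<longlonglongrightarrow> deriv (\<lambda>w. f w t) w" if t: "t \<in> space M" for t
      proof -
        have "((\<lambda>x. q x t) \<longlongrightarrow> deriv (\<lambda>w. f w t) w) (at w)"
          using der[OF w t] by (simp add: q_def has_field_derivative_iff)
        thus ?thesis using X by (auto simp: tendsto_at_iff_sequentially comp_def)
      qed
      have qmeas: "q (X i) \<in> borel_measurable M" for i
        using meas[OF w] meas[OF XS[of i]] unfolding q_def by measurable
      show "(\<lambda>i. \<integral>t. q (X i) t \<partial>M) \<longlonglongrightarrow> (\<integral>t. deriv (\<lambda>w. f w t) w \<partial>M)"
        by (rule integral_dominated_convergence[where w = "\<lambda>t. h t / r"])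
           (use X h lim qbound qmeas in \<open>auto intro!: AE_I2 borel_measurable_LIMSEQ_metric[OF qmeas]\<close>)
    qed
    hence "((\<lambda>x. \<integral>t. q x t \<partial>M) \<longlongrightarrow> (\<integral>t. deriv (\<lambda>w. f w t) w \<partial>M)) (at w)"
      using r by (subst (asm) at_within_interior) auto
    moreover have "\<forall>\<^sub>F x in at w. (\<integral>t. q x t \<partial>M) = ((\<integral>t. f x t \<partial>M) - (\<integral>t. f w t \<partial>M)) / (x - w)"
    proof -
      have "\<forall>\<^sub>F x in at w. x \<in> S"
        using S w by (simp add: eventually_at_in_open')
      thus ?thesis
        by eventually_elim (use int w in \<open>simp add: q_def\<close>)
    qed
    ultimately show ?thesis
      unfolding has_field_derivative_iff by (blast intro: Lim_transform_eventually)
  qed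
  thus ?thesis using S by (simp add: holomorphic_on_open)
qed

section \<open>The Lerch series\<close>

text \<open>A complex exponent multiplies the modulus by at most \<open>exp (pi * \<bar>Im b\<bar>)\<close>, because the principal
  argument stays between \<open>-pi\<close> and \<open>pi\<close>.\<close>

lemma norm_powr_le:
  fixes u b :: complex
  shows "norm (u powr b) \<le> norm u powr Re b * exp (pi * \<bar>Im b\<bar>)"
proof -
  have "- Im b * Arg u \<le> \<bar>Im b\<bar> * \<bar>Arg u\<bar>"
    by (metis abs_le_D2 abs_mult minus_mult_left order_refl)
  also have "\<dots> \<le> \<bar>Im b\<bar> * pi"
    using Arg_bounded[of u] by (intro mult_left_mono) auto
  finally show ?thesis
    by (simp add: norm_powr_complex mult_left_mono mult.commute)
qed

lemma powr_of_nat_mult: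
  assumes "n > 0"
  shows "(of_nat n * x) powr (s :: complex) = of_nat n powr s * x powr s"
proof (cases "x = 0")
  case False
  have "Ln (of_nat n * x) = of_real (ln (real n)) + Ln x"
    using Ln_times_of_real[of "real n" x] assms False by simp
  thus ?thesis
    using False assms by (simp add: powr_def exp_add algebra_simps Ln_of_nat)
qed auto

lemma powr_le_2_powr:
  fixes x a :: real
  assumes "1 / 2 \<le> x" "x \<le> 2"
  shows "x powr a \<le> 2 powr \<bar>a\<bar>"
proof -
  have "\<bar>ln x\<bar> \<le> ln 2"
    using assms ln_mono[of "1/2" x] ln_mono[of x 2] by (auto simp: ln_div abs_le_iff)
  hence "\<bar>a\<bar> * \<bar>ln x\<bar> \<le> \<bar>a\<bar> * ln 2"
    by (intro mult_left_mono) auto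
  hence "a * ln x \<le> \<bar>a\<bar> * ln 2"
    using abs_ge_self[of "a * ln x"] by (simp add: abs_mult)
  thus ?thesis using assms by (simp add: powr_def)
qed

text \<open>For large \<open>j\<close> the quotient \<open>\<bar>j + v\<bar> / j\<close> lies between 1/2 and 2, so the shift by \<open>v\<close> costs only a
  constant factor. The bound is uniform in \<open>s\<close>, as the Weierstrass test in \<open>s\<close> demands.\<close>

lemma eventually_shifted_powr_bound:
  fixes v :: complex and \<sigma> B :: real
  shows "\<forall>\<^sub>F j in sequentially. \<forall>s. \<sigma> \<le> Re s \<longrightarrow> \<bar>Im s\<bar> \<le> B \<longrightarrow>
           norm ((of_nat j + v) powr (-s)) \<le> 2 powr \<bar>\<sigma>\<bar> * exp (pi * B) * real j powr (-\<sigma>)"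
proof -
  have "\<forall>\<^sub>F j in sequentially. 2 * norm v + 2 \<le> real j"
    by real_asymp
  thus ?thesis
  proof (eventually_elim, intro allI impI)
    fix j :: nat and s :: complex
    assume j: "2 * norm v + 2 \<le> real j" and s: "\<sigma> \<le> Re s" "\<bar>Im s\<bar> \<le> B"
    define u where "u = of_nat j + v"
    have j0: "real j \<ge> 2"
      using j by (smt (verit) norm_ge_zero)
    have u: "real j / 2 \<le> norm u" "norm u \<le> 2 * real j"
      using j norm_triangle_ineq[of "of_nat j" v] norm_diff_ineq[of "of_nat j" v] by (auto simp: u_def)
    have "norm (u powr (-s)) \<le> norm u powr Re (-s) * exp (pi * \<bar>Im (-s)\<bar>)"
      by (rule norm_powr_le)
    also have "\<dots> \<le> norm u powr (-\<sigma>) * exp (pi * B)"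
      using s u j0 by (intro mult_mono powr_mono) auto
    also have "norm u powr (-\<sigma>) = (norm u / real j) powr (-\<sigma>) * real j powr (-\<sigma>)"
      using j0 by (subst powr_mult [symmetric]) auto
    also have "\<dots> * exp (pi * B) \<le> 2 powr \<bar>\<sigma>\<bar> * real j powr (-\<sigma>) * exp (pi * B)"
      using powr_le_2_powr[of "norm u / real j" "-\<sigma>"] u j0
      by (intro mult_right_mono) (simp_all add: divide_simps)
    finally show "norm ((of_nat j + v) powr (-s)) \<le> 2 powr \<bar>\<sigma>\<bar> * exp (pi * B) * real j powr (-\<sigma>)"
      by (simp add: u_def mult_ac)
  qed
qed

lemma summable_powr_times_power:
  fixes a q :: real
  assumes "0 \<le> q" "q < 1"
  shows "summable (\<lambda>j. real j powr a * q ^ j)"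
proof -
  define p where "p = max q (1 / 2)"
  have p: "0 < p" "p < 1" "q \<le> p"
    using assms by (auto simp: p_def)
  have "(\<lambda>j. real j powr a * p ^ j) \<in> O(\<lambda>j. real j powr (-2))"
    using p(1,2) by real_asymp
  hence "summable (\<lambda>j. real j powr a * p ^ j)"
    by (rule summable_comparison_test_bigo[rotated]) (simp add: summable_real_powr_iff)
  thus ?thesis
    by (rule summable_comparison_test_ev[rotated])
       (use p assms in \<open>auto intro!: always_eventually mult_left_mono power_mono\<close>)
qed

lemma summable_shifted_powr:
  assumes "norm z < 1 \<or> norm z = 1 \<and> Re s > 1"
  shows "summable (\<lambda>j. norm (z ^ j * (of_nat j + v) powr (-s)))"
proof -
  define C where "C = 2 powr \<bar>Re s\<bar> * exp (pi * \<bar>Im s\<bar>)"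
  have "\<forall>\<^sub>F j in sequentially. norm ((of_nat j + v) powr (-s)) \<le> C * real j powr (-Re s)"
    using eventually_shifted_powr_bound[of "Re s" "\<bar>Im s\<bar>" v] by eventually_elim (auto simp: C_def)
  hence "\<forall>\<^sub>F j in sequentially. norm (norm (z ^ j * (of_nat j + v) powr (-s))) \<le>
           C * (real j powr (-Re s) * norm z ^ j)"
  proof eventually_elim
    case (elim j)
    from mult_left_mono[OF this, of "norm z ^ j"] show ?case
      by (simp add: norm_mult norm_power mult_ac)
  qed
  moreover have "summable (\<lambda>j. C * (real j powr (-Re s) * norm z ^ j))"
    using assms summable_powr_times_power[of "norm z" "-Re s"]
    by (intro summable_mult) (auto simp: summable_real_powr_iff)
  ultimately show ?thesis
    by (rule summable_comparison_test_ev)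
qed

lemma lerch_series_altdef: "lerch_series z s v = (\<Sum>j. z ^ j * (of_nat j + v) powr (-s))"
  by (simp add: lerch_series_def powr_minus divide_inverse)

lemma lerch_series_sums:
  assumes "norm z < 1 \<or> norm z = 1 \<and> Re s > 1"
  shows "(\<lambda>j. z ^ j * (of_nat j + v) powr (-s)) sums lerch_series z s v"
  using summable_norm_cancel[OF summable_shifted_powr[OF assms]]
  unfolding lerch_series_altdef by (rule summable_sums)

lemma lerch_series_shift:
  assumes "norm z < 1 \<or> norm z = 1 \<and> Re s > 1"
  shows "lerch_series z s v =
           (\<Sum>j<N. z ^ j * (of_nat j + v) powr (-s)) + z ^ N * lerch_series z s (v + of_nat N)"
proof -
  have "(\<lambda>j. z ^ N * (z ^ j * (of_nat j + (v + of_nat N)) powr (-s)))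
          sums (z ^ N * lerch_series z s (v + of_nat N))"
    by (intro sums_mult lerch_series_sums assms)
  hence "(\<lambda>j. z ^ (j + N) * (of_nat (j + N) + v) powr (-s))
          sums (z ^ N * lerch_series z s (v + of_nat N))"
    by (simp add: power_add algebra_simps)
  hence "(\<lambda>j. z ^ j * (of_nat j + v) powr (-s))
          sums (z ^ N * lerch_series z s (v + of_nat N) + (\<Sum>j<N. z ^ j * (of_nat j + v) powr (-s)))"
    using sums_iff_shift[of "\<lambda>j. z ^ j * (of_nat j + v) powr (-s)" N] by simp
  from sums_unique2[OF lerch_series_sums[OF assms] this] show ?thesis
    by (simp only: add.commute)
qed

text \<open>Splitting the summation index as \<open>q * n + r\<close> gives
  \<open>q * n + r + v = n * (q + (v + r) / n)\<close>, and a positive factor \<open>n\<close> can be pulled out of a principal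
  power.\<close>

lemma lerch_series_multiplication:
  assumes w: "norm w < 1 \<or> norm w = 1 \<and> Re s > 1" and n: "n > 0"
  shows "lerch_series w s v =
           of_nat n powr (-s) * (\<Sum>r<n. w ^ r * lerch_series (w ^ n) s ((v + of_nat r) / of_nat n))"
proof -
  let ?f = "\<lambda>j. w ^ j * (of_nat j + v) powr (-s)"
  have wn: "norm (w ^ n) < 1 \<or> norm (w ^ n) = 1 \<and> Re s > 1"
    using w n by (auto simp: norm_power power_less_one_iff)
  have term_eq: "?f (q * n + r) = of_nat n powr (-s) *
      (w ^ r * ((w ^ n) ^ q * (of_nat q + (v + of_nat r) / of_nat n) powr (-s)))" for q r
  proof -
    have "of_nat (q * n + r) + v = of_nat n * (of_nat q + (v + of_nat r) / of_nat n)"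
      using n by (simp add: field_simps)
    hence "(of_nat (q * n + r) + v) powr (-s) =
             of_nat n powr (-s) * (of_nat q + (v + of_nat r) / of_nat n) powr (-s)"
      using powr_of_nat_mult[OF n] by metis
    moreover have "w ^ (q * n + r) = (w ^ n) ^ q * w ^ r"
      by (simp add: power_add power_mult mult.commute[of q])
    ultimately show ?thesis by (simp add: mult_ac)
  qed
  have "(\<lambda>q. sum ?f {q * n..<q * n + n}) sums lerch_series w s v"
    by (intro sums_group lerch_series_sums w n)
  moreover have "sum ?f {q * n..<q * n + n} = (\<Sum>r<n. ?f (q * n + r))" for q
    using sum.shift_bounds_nat_ivl[of ?f 0 "q * n" n] by (simp add: add.commute atLeast0LessThan)
  ultimately have "(\<lambda>q. \<Sum>r<n. ?f (q * n + r)) sums lerch_series w s v"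
    by simp
  moreover have "(\<lambda>q. \<Sum>r<n. ?f (q * n + r)) sums
      (\<Sum>r<n. of_nat n powr (-s) * (w ^ r * lerch_series (w ^ n) s ((v + of_nat r) / of_nat n)))"
    unfolding term_eq by (intro sums_sum sums_mult lerch_series_sums wn)
  ultimately show ?thesis
    unfolding sum_distrib_left by (rule sums_unique2)
qed

text \<open>Continuity up to the unit circle is what identifies the continuation with the series at
  points of the circle, where the series itself serves as the definition if \<open>Re s > 1\<close>.\<close>

lemma continuous_on_lerch_series:
  assumes "Re s > 1"
  shows "continuous_on (cball 0 1) (\<lambda>z. lerch_series z s v)"
proof -
  have "uniform_limit (cball 0 1) (\<lambda>n z. \<Sum>j<n. z ^ j * (of_nat j + v) powr (-s))
          (\<lambda>z. \<Sum>j. z ^ j * (of_nat j + v) powr (-s)) sequentially"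
  proof (rule Weierstrass_m_test)
    show "summable (\<lambda>j. norm ((of_nat j + v) powr (-s)))"
      using summable_shifted_powr[of 1 s v] assms by simp
  qed (auto simp: norm_mult norm_power intro!: mult_left_le_one_le power_le_one)
  thus ?thesis
    unfolding lerch_series_altdef
    by (rule uniform_limit_theorem[rotated]) (auto intro!: always_eventually continuous_intros)
qed

lemma holomorphic_lerch_series:
  assumes "norm z \<le> 1"
  shows "(\<lambda>s. lerch_series z s v) holomorphic_on {s. Re s > 1}"
  unfolding lerch_series_altdef
proof (rule holomorphic_suminf)
  show "open {s. 1 < Re s}"
    by (rule open_halfspace_Re_gt)
next
  fix x assume x: "x \<in> {s. 1 < Re s}"
  define d where "d = (Re x - 1) / 2"
  define \<sigma> where "\<sigma> = 1 + d"
  have d: "d > 0"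
    using x by (simp add: d_def)
  define M where "M = (\<lambda>j. 2 powr \<bar>\<sigma>\<bar> * exp (pi * (\<bar>Im x\<bar> + d)) * real j powr (-\<sigma>))"
  have "\<forall>\<^sub>F j in sequentially. \<forall>y\<in>ball x d \<inter> {s. 1 < Re s}.
          norm (z ^ j * (of_nat j + v) powr (-y)) \<le> M j"
    using eventually_shifted_powr_bound[of \<sigma> "\<bar>Im x\<bar> + d" v]
  proof (eventually_elim, intro ballI)
    fix j y
    assume le: "\<forall>s. \<sigma> \<le> Re s \<longrightarrow> \<bar>Im s\<bar> \<le> \<bar>Im x\<bar> + d \<longrightarrow> norm ((of_nat j + v) powr (-s))
                 \<le> 2 powr \<bar>\<sigma>\<bar> * exp (pi * (\<bar>Im x\<bar> + d)) * real j powr (-\<sigma>)"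
      and y: "y \<in> ball x d \<inter> {s. 1 < Re s}"
    have "\<bar>Re (x - y)\<bar> < d" "\<bar>Im (x - y)\<bar> < d"
      using y abs_Re_le_cmod[of "x - y"] abs_Im_le_cmod[of "x - y"] by (auto simp: dist_norm)
    moreover have "\<sigma> = Re x - d"
      by (simp add: \<sigma>_def d_def field_simps)
    ultimately have "\<sigma> \<le> Re y" "\<bar>Im y\<bar> \<le> \<bar>Im x\<bar> + d"
      by auto
    hence "norm ((of_nat j + v) powr (-y)) \<le> M j"
      using le by (auto simp: M_def)
    moreover have "norm (z ^ j) \<le> 1"
      using assms by (simp add: norm_power power_le_one)
    ultimately show "norm (z ^ j * (of_nat j + v) powr (-y)) \<le> M j"
      unfolding norm_mult by (intro order_trans[OF mult_left_le_one_le]) auto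
  qed
  moreover have "summable M"
    unfolding M_def using d by (intro summable_mult) (simp add: summable_real_powr_iff \<sigma>_def)
  ultimately show "\<exists>d>0. \<exists>M. summable M \<and> (\<forall>\<^sub>F j in sequentially. \<forall>y\<in>ball x d \<inter> {s. 1 < Re s}.
                     norm (z ^ j * (of_nat j + v) powr (-y)) \<le> M j)"
    using d by blast
qed (auto intro!: holomorphic_intros)

section \<open>The Gamma integral with a complex rate\<close>

abbreviation halfline :: "real measure" where
  "halfline \<equiv> restrict_space lborel {0<..}"

lemma borel_measurable_halfline:
  fixes f :: "real \<Rightarrow> complex"
  assumes "continuous_on {0<..} f"
  shows "f \<in> borel_measurable halfline"
proof -
  have "sets halfline = sets (restrict_space borel {0<..})"
    by (rule sets_restrict_space_cong) simp
  from measurable_cong_sets[OF this refl] show ?thesis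
    using borel_measurable_continuous_on_restrict[OF assms] by blast
qed

text \<open>Only the modulus of the integrand matters, so this reduces to the real rate \<open>Re u\<close>.\<close>

lemma integrable_Gamma_kernel:
  assumes q: "Re q > 0" and u: "Re u > 0"
  shows "integrable halfline (\<lambda>t. complex_of_real t powr (q - 1) * exp (- (u * of_real t)))"
proof -
  let ?g = "\<lambda>t. complex_of_real t powr (q - 1) / of_real (exp (Re u * t))"
  have meas: "(\<lambda>t. indicator {0<..} t *\<^sub>R ?g t) \<in> borel_measurable lborel"
    by (subst borel_measurable_restrict_space_iff[symmetric])
       (auto intro!: borel_measurable_halfline continuous_intros)
  have "set_integrable lebesgue {0<..} ?g"
    using absolutely_integrable_Gamma_integral[OF q u] .
  hence "integrable lborel (\<lambda>t. indicator {0<..} t *\<^sub>R ?g t)"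
    unfolding set_integrable_def using integrable_completion[OF meas] by simp
  hence int: "integrable halfline ?g"
    by (subst integrable_restrict_space) auto
  show ?thesis
    by (rule Bochner_Integration.integrable_bound[OF int])
       (auto intro!: borel_measurable_halfline continuous_intros AE_I2
             simp: norm_mult norm_divide exp_minus field_simps space_restrict_space)
qed

lemma integrable_Gamma_kernel_real:
  assumes "x > 0" "a > 0"
  shows "integrable halfline (\<lambda>t. t powr (x - 1) * exp (- (a * t)))"
proof -
  have "integrable halfline (\<lambda>t. norm (complex_of_real t powr (of_real x - 1) *
          exp (- (of_real a * of_real t))))"
    by (intro integrable_norm integrable_Gamma_kernel) (use assms in auto)
  also have "?this \<longleftrightarrow> ?thesis"
    by (intro Bochner_Integration.integrable_cong refl)
       (auto simp: space_restrict_space norm_mult norm_powr_real_powr)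
  finally show ?thesis .
qed

text \<open>The substitution \<open>t \<mapsto> a * t\<close> in Euler's integral.\<close>

lemma Gamma_kernel_integral_real:
  assumes q: "Re q > 0" and a: "a > 0"
  shows "(\<integral>t. complex_of_real t powr (q - 1) * exp (- (of_real a * of_real t)) \<partial>halfline) =
           Gamma q * of_real a powr (-q)"
proof -
  let ?g = "\<lambda>t. complex_of_real t powr (q - 1) / of_real (exp t)"
  have meas: "(\<lambda>t. indicator {0<..} t *\<^sub>R ?g t) \<in> borel_measurable lborel"
    by (subst borel_measurable_restrict_space_iff[symmetric])
       (auto intro!: borel_measurable_halfline continuous_intros)
  have "set_integrable lebesgue {0<..} ?g"
    using absolutely_integrable_Gamma_integral'[OF q] .
  hence "(\<integral>t. indicator {0<..} t *\<^sub>R ?g t \<partial>lebesgue) = Gamma q"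
    using set_lebesgue_integral_eq_integral(2) integral_unique[OF Gamma_integral_complex'[OF q]]
    unfolding set_lebesgue_integral_def by metis
  hence "Gamma q = (\<integral>t. indicator {0<..} t *\<^sub>R ?g t \<partial>lborel)"
    using integral_completion[OF meas] by simp
  also have "\<dots> = a *\<^sub>R (\<integral>t. indicator {0<..} (a * t) *\<^sub>R ?g (a * t) \<partial>lborel)"
    using a by (subst lborel_integral_real_affine[of a _ 0]) auto
  also have "(\<lambda>t. indicator {0<..} (a * t) *\<^sub>R ?g (a * t)) =
      (\<lambda>t. of_real a powr (q - 1) * (indicator {0<..} t *\<^sub>R
              (complex_of_real t powr (q - 1) * exp (- (of_real a * of_real t)))))"
    using a by (auto simp: fun_eq_iff indicator_def zero_less_mult_iff powr_times_real
        exp_minus divide_inverse exp_of_real [symmetric])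
  also have "a *\<^sub>R (\<integral>t. \<dots> t \<partial>lborel) = (a *\<^sub>R of_real a powr (q - 1)) *
      (\<integral>t. complex_of_real t powr (q - 1) * exp (- (of_real a * of_real t)) \<partial>halfline)"
    by (subst integral_restrict_space) (simp_all only: integral_mult_right_zero, auto)
  also have "a *\<^sub>R of_real a powr (q - 1) = of_real a powr q"
    using a by (simp add: powr_diff scaleR_conv_of_real)
  finally show ?thesis
    using a by (simp add: powr_minus field_simps)
qed

text \<open>A complex rate \<open>u\<close> cannot be scaled away by a real substitution. Instead both sides are
  holomorphic in \<open>u\<close> on the right half-plane and agree on the positive real axis.\<close>

lemma Gamma_kernel_integral:
  assumes q: "Re q > 0" and u: "Re u > 0"
  shows "(\<integral>t. complex_of_real t powr (q - 1) * exp (- (u * of_real t)) \<partial>halfline) =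
           Gamma q * u powr (-q)"
proof -
  define S where "S = {u. Re u > 0}"
  define F where "F = (\<lambda>u. (\<integral>t. complex_of_real t powr (q - 1) * exp (- (u * of_real t)) \<partial>halfline)
                            - Gamma q * u powr (-q))"
  have S: "open S" "connected S"
    unfolding S_def by (auto simp: open_halfspace_Re_gt intro: convex_connected convex_halfspace_Re_gt)
  have "(\<lambda>u. \<integral>t. complex_of_real t powr (q - 1) * exp (- (u * of_real t)) \<partial>halfline) holomorphic_on S"
  proof (rule holomorphic_integral[OF S(1)])
    fix w assume w: "w \<in> S"
    define a where "a = Re w / 2"
    have a: "a > 0" using w by (simp add: a_def S_def)
    have "norm (complex_of_real t powr (q - 1) * exp (- (x * of_real t))) \<le>
            t powr (Re q - 1) * exp (- (a * t))" if "x \<in> ball w a \<inter> S" "t \<in> space halfline" for x t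
    proof -
      have "Re (w - x) < a"
        using that complex_Re_le_cmod[of "w - x"] by (auto simp: dist_norm)
      hence "a \<le> Re x"
        by (simp add: a_def)
      thus ?thesis
        using that by (auto simp: norm_mult norm_powr_real_powr space_restrict_space intro!: mult_left_mono)
    qed
    thus "\<exists>d>0. \<exists>h. integrable halfline h \<and> (\<forall>x\<in>ball w d \<inter> S. \<forall>t\<in>space halfline.
             norm (complex_of_real t powr (q - 1) * exp (- (x * of_real t))) \<le> h t)"
      using a integrable_Gamma_kernel_real[OF q a] by blast
  qed (auto intro!: holomorphic_intros borel_measurable_halfline continuous_intros)
  hence hol: "F holomorphic_on S"
    unfolding F_def by (auto intro!: holomorphic_intros simp: S_def complex_nonpos_Reals_iff)
  have "connected (complex_of_real ` {0<..})"
    by (intro connected_continuous_image continuous_intros) auto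
  moreover have mem: "1 \<in> complex_of_real ` {0<..}" "2 \<in> complex_of_real ` {0<..}"
    by (auto simp: image_iff intro: bexI[of _ 1] bexI[of _ 2])
  moreover have "complex_of_real ` {0<..} \<noteq> {x}" for x
  proof
    assume "complex_of_real ` {0<..} = {x}"
    hence "1 = x" "2 = x" using mem by auto
    thus False by simp
  qed
  ultimately have islimpt: "1 islimpt (complex_of_real ` {0<..})"
    by (intro connected_imp_perfect)
  have zero: "F z = 0" if "z \<in> complex_of_real ` {0<..}" for z
    using that Gamma_kernel_integral_real[OF q] by (auto simp: F_def)
  have "F u = 0"
    by (rule analytic_continuation[OF hol S _ _ islimpt zero]) (use u in \<open>auto simp: S_def\<close>)
  thus ?thesis by (simp add: F_def)
qed

section \<open>Continuation in \<open>z\<close> to the slit plane\<close>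

text \<open>The rational function that continues \<open>\<Sum>j. (j + v) ^ p * y ^ j\<close>: applying the operator
  \<open>v + y * d/dy\<close> multiplies the coefficient of \<open>y ^ j\<close> by \<open>j + v\<close>. Its only pole is \<open>y = 1\<close>.\<close>

primrec lerch_kernel :: "complex \<Rightarrow> nat \<Rightarrow> complex \<Rightarrow> complex" where
  "lerch_kernel v 0 = (\<lambda>y. 1 / (1 - y))"
| "lerch_kernel v (Suc p) = (\<lambda>y. v * lerch_kernel v p y + y * deriv (lerch_kernel v p) y)"

lemma holomorphic_lerch_kernel: "lerch_kernel v p holomorphic_on - {1}"
  by (induction p) (auto intro!: holomorphic_intros simp: open_Compl)

lemma lerch_kernel_sums:
  assumes "norm y < 1"
  shows "(\<lambda>j. (of_nat j + v) ^ p * y ^ j) sums lerch_kernel v p y"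
  using assms
proof (induction p arbitrary: y)
  case 0
  thus ?case by (simp add: geometric_sums)
next
  case (Suc p)
  define c where "c = (\<lambda>j. (of_nat j + v) ^ p)"
  have sums: "(\<lambda>j. c j * z ^ j) sums lerch_kernel v p z" if "norm z < 1" for z
    using Suc.IH[OF that] by (simp add: c_def)
  have summ: "summable (\<lambda>j. c j * z ^ j)" if "norm z < 1" for z
    using sums[OF that] by (rule sums_summable)
  have "((\<lambda>z. \<Sum>j. c j * z ^ j) has_field_derivative (\<Sum>j. diffs c j * y ^ j)) (at y)"
    by (rule termdiffs_strong'[OF summ Suc.prems])
  moreover have "\<forall>\<^sub>F z in nhds y. (\<Sum>j. c j * z ^ j) = lerch_kernel v p z"
  proof -
    have "\<forall>\<^sub>F z in nhds y. z \<in> ball 0 1"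
      using Suc.prems by (intro eventually_nhds_in_open) auto
    thus ?thesis
      by eventually_elim (use sums in \<open>auto simp: sums_iff\<close>)
  qed
  ultimately have "(lerch_kernel v p has_field_derivative (\<Sum>j. diffs c j * y ^ j)) (at y)"
    by (subst (asm) DERIV_cong_ev[OF refl _ refl])
  hence "deriv (lerch_kernel v p) y = (\<Sum>j. diffs c j * y ^ j)"
    by (rule DERIV_imp_deriv)
  hence "(\<lambda>j. diffs c j * y ^ j) sums deriv (lerch_kernel v p) y"
    using termdiff_converges[OF Suc.prems summ] by (simp add: summable_sums)
  hence "(\<lambda>j. of_nat j * c j * y ^ (j - Suc 0)) sums deriv (lerch_kernel v p) y"
    using diffs_equiv[of c y] termdiff_converges[OF Suc.prems summ] by (metis sums_unique2 summable_sums)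
  hence "(\<lambda>j. y * (of_nat j * c j * y ^ (j - Suc 0))) sums (y * deriv (lerch_kernel v p) y)"
    by (rule sums_mult)
  also have "(\<lambda>j. y * (of_nat j * c j * y ^ (j - Suc 0))) = (\<lambda>j. of_nat j * c j * y ^ j)"
    by (rule ext) (case_tac j, auto)
  finally have "(\<lambda>j. v * (c j * y ^ j) + of_nat j * c j * y ^ j) sums lerch_kernel v (Suc p) y"
    unfolding lerch_kernel.simps by (intro sums_add sums_mult sums Suc.prems)
  thus ?case by (simp add: c_def algebra_simps)
qed

abbreviation slit_plane :: "complex set" where
  "slit_plane \<equiv> - complex_of_real ` {1..}"

text \<open>Star-shapedness about 0, which makes continuation from the unit disc unambiguous.\<close>

lemma slit_plane_mult:
  assumes "z \<in> slit_plane" "0 \<le> x" "x \<le> 1"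
  shows "z * of_real x \<in> slit_plane"
proof
  assume "z * of_real x \<in> complex_of_real ` {1..}"
  then obtain y where y: "z * of_real x = of_real y" "y \<ge> 1" by auto
  with assms(2) have "x \<noteq> 0" "x > 0" by (auto simp: less_le)
  hence "z = of_real (y / x)" using y by (simp add: field_simps)
  moreover have "y / x \<ge> 1" using y assms(3) \<open>x > 0\<close> by (simp add: field_simps)
  ultimately show False using assms(1) by (metis ComplD atLeast_iff imageI)
qed

lemma open_slit_plane: "open slit_plane"
proof -
  have "complex_of_real ` {1..} = {z. Im z = 0 \<and> 1 \<le> Re z}"
    by (auto simp: image_iff complex_eq_iff intro!: bexI[of _ "Re _"])
  moreover have "closed {z. Im z = 0 \<and> 1 \<le> Re z}"
    by (intro closed_Collect_conj closed_Collect_eq closed_Collect_le continuous_intros)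
  ultimately show ?thesis by (simp add: open_Compl)
qed

lemma connected_slit_plane: "connected slit_plane"
proof -
  have "starlike slit_plane"
    unfolding starlike_def
  proof (intro bexI[of _ 0] ballI subsetI)
    fix x z :: complex assume x: "x \<in> slit_plane" and z: "z \<in> closed_segment 0 x"
    obtain t where t: "0 \<le> t" "t \<le> 1" "z = (1 - t) *\<^sub>R 0 + t *\<^sub>R x"
      using z unfolding in_segment by blast
    hence "z = x * of_real t"
      by (simp add: scaleR_conv_of_real)
    thus "z \<in> slit_plane"
      using slit_plane_mult[OF x t(1,2)] by simp
  qed auto
  thus ?thesis by (rule starlike_imp_connected)
qed

lemma ball_subset_slit_plane: "ball 0 1 \<subseteq> slit_plane"
  by auto

text \<open>The points \<open>x * exp (-t)\<close> lie in the cone over a disc around \<open>z\<close>, which is compact and misses the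
  pole 1 of the kernel.\<close>

lemma lerch_kernel_bounded:
  assumes "z \<in> slit_plane"
  obtains d B where "d > 0" "\<And>x t. x \<in> ball z d \<Longrightarrow> t > 0 \<Longrightarrow>
     norm (lerch_kernel v p (x * of_real (exp (-t)))) \<le> B"
proof -
  obtain d where d: "d > 0" "cball z d \<subseteq> slit_plane"
    using assms open_slit_plane open_contains_cball by blast
  define K where "K = (\<lambda>(x, y). x * complex_of_real y) ` (cball z d \<times> {0..1})"
  have "compact K"
    unfolding K_def
    by (intro compact_continuous_image compact_Times) (auto simp: case_prod_unfold intro!: continuous_intros)
  moreover have "K \<subseteq> - {1}"
    using slit_plane_mult d(2) by (force simp: K_def)
  ultimately have "compact (lerch_kernel v p ` K)"
    using holomorphic_on_imp_continuous_on[OF holomorphic_lerch_kernel]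
    by (blast intro: compact_continuous_image continuous_on_subset)
  then obtain B where "\<forall>y\<in>lerch_kernel v p ` K. norm y \<le> B"
    using compact_imp_bounded bounded_iff by blast
  thus ?thesis
    by (intro that[OF d(1)]) (force simp: K_def)
qed

text \<open>A Mellin integral for the Lerch function. With \<open>p = 0\<close> it is the classical
  \<open>1 / Gamma s * \<integral> t powr (s - 1) * exp (-v * t) / (1 - z * exp (-t))\<close>, which converges for
  \<open>Re s > 0\<close>; the kernel with the extra factors \<open>(j + v) ^ p\<close> raises the exponent from \<open>s\<close> to \<open>s + p\<close>
  and so reaches the half-plane \<open>Re s > -p\<close>.\<close>

definition lerch_integral :: "nat \<Rightarrow> complex \<Rightarrow> complex \<Rightarrow> complex \<Rightarrow> complex" where
  "lerch_integral p z s v = rGamma (s + of_nat p) *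
     (\<integral>t. of_real t powr (s + of_nat p - 1) * exp (- (v * of_real t)) *
           lerch_kernel v p (z * of_real (exp (-t))) \<partial>halfline)"

lemma slit_plane_mult_exp_ne_1:
  assumes "z \<in> slit_plane" "t > 0"
  shows "z * of_real (exp (-t)) \<noteq> 1"
proof
  assume "z * of_real (exp (-t)) = 1"
  moreover have "z * of_real (exp (-t)) \<in> slit_plane"
    using assms by (intro slit_plane_mult) auto
  ultimately show False
    by (metis ComplD atLeast_iff image_eqI of_real_1 order_refl)
qed

lemma continuous_on_lerch_kernel_exp:
  assumes "z \<in> slit_plane"
  shows "continuous_on {0<..} (\<lambda>t. lerch_kernel v p (z * of_real (exp (-t))))"
proof (rule continuous_on_compose2[OF holomorphic_on_imp_continuous_on[OF holomorphic_lerch_kernel]])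
  show "continuous_on {0<..} (\<lambda>t. z * complex_of_real (exp (-t)))"
    by (intro continuous_intros)
  show "(\<lambda>t. z * complex_of_real (exp (-t))) ` {0<..} \<subseteq> - {1}"
  proof (rule image_subsetI)
    fix t :: real assume "t \<in> {0<..}"
    thus "z * complex_of_real (exp (-t)) \<in> - {1}"
      using slit_plane_mult_exp_ne_1[OF assms, of t] by blast
  qed
qed

lemma borel_measurable_lerch_integrand:
  assumes "z \<in> slit_plane"
  shows "(\<lambda>t. of_real t powr q * exp (- (v * of_real t)) *
              lerch_kernel v p (z * of_real (exp (-t)))) \<in> borel_measurable halfline"
proof -
  have "continuous_on {0<..} (\<lambda>t. complex_of_real t powr q * exp (- (v * of_real t)))"
    by (intro continuous_intros) auto
  from continuous_on_mult[OF this continuous_on_lerch_kernel_exp[OF assms]] show ?thesis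
    by (rule borel_measurable_halfline)
qed

lemma holomorphic_lerch_integral_z:
  assumes v: "Re v > 0" and s: "Re s + real p > 0"
  shows "(\<lambda>z. lerch_integral p z s v) holomorphic_on slit_plane"
proof -
  let ?f = "\<lambda>z t. of_real t powr (s + of_nat p - 1) * exp (- (v * of_real t)) *
                 lerch_kernel v p (z * complex_of_real (exp (-t)))"
  have "(\<lambda>z. \<integral>t. ?f z t \<partial>halfline) holomorphic_on slit_plane"
  proof (rule holomorphic_integral[OF open_slit_plane])
    fix t assume "t \<in> space halfline"
    hence t: "t > 0" by (simp add: space_restrict_space)
    have "(\<lambda>z. lerch_kernel v p (z * complex_of_real (exp (-t)))) holomorphic_on slit_plane"
      by (rule holomorphic_on_compose_gen[OF _ holomorphic_lerch_kernel, unfolded o_def])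
         (use slit_plane_mult_exp_ne_1[OF _ t] in \<open>auto intro!: holomorphic_intros\<close>)
    thus "(\<lambda>z. ?f z t) holomorphic_on slit_plane"
      by (intro holomorphic_intros)
  next
    fix z assume z: "z \<in> slit_plane"
    obtain d B where dB: "d > 0" "\<And>x t. x \<in> ball z d \<Longrightarrow> t > 0 \<Longrightarrow>
        norm (lerch_kernel v p (x * of_real (exp (-t)))) \<le> B"
      using lerch_kernel_bounded[OF z] by metis
    let ?h = "\<lambda>t. norm (complex_of_real t powr (s + of_nat p - 1) * exp (- (v * of_real t))) * B"
    have int: "integrable halfline ?h"
      by (intro integrable_mult_left integrable_norm integrable_Gamma_kernel) (use v s in auto)
    have le: "norm (?f x t) \<le> ?h t" if "x \<in> ball z d \<inter> slit_plane" "t \<in> space halfline" for x t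
      unfolding norm_mult[of "_ * _"] using dB(2)[of x t] that
      by (intro mult_left_mono) (auto simp: space_restrict_space)
    show "\<exists>d>0. \<exists>h. integrable halfline h \<and>
        (\<forall>x\<in>ball z d \<inter> slit_plane. \<forall>t\<in>space halfline. norm (?f x t) \<le> h t)"
      by (intro exI[of _ d] exI[of _ ?h] conjI ballI dB(1) int le)
  qed (rule borel_measurable_lerch_integrand)
  thus ?thesis
    unfolding lerch_integral_def by (intro holomorphic_intros)
qed

lemma powr_le_sum_of_endpoints:
  fixes t a b x :: real
  assumes "t > 0" "a \<le> x" "x \<le> b"
  shows "t powr x \<le> t powr a + t powr b"
proof (cases "t \<le> 1")
  case True
  hence "t powr x \<le> t powr a" using assms by (intro powr_mono') auto
  thus ?thesis by (simp add: add_increasing2)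
next
  case False
  hence "t powr x \<le> t powr b" using assms by (intro powr_mono) auto
  thus ?thesis by (simp add: add_increasing)
qed

text \<open>A dominating function that works for all \<open>s\<close> in a small disc needs one power of \<open>t\<close> for \<open>t \<le> 1\<close> and
  another for \<open>t \<ge> 1\<close>; the sum of the two serves everywhere.\<close>

lemma holomorphic_lerch_integral_s:
  assumes v: "Re v > 0" and z: "z \<in> slit_plane"
  shows "(\<lambda>s. lerch_integral p z s v) holomorphic_on {s. Re s > - real p}"
proof -
  define S where "S = {s. Re s > - real p}"
  have S: "open S" unfolding S_def by (rule open_halfspace_Re_gt)
  let ?f = "\<lambda>s t. of_real t powr (s + of_nat p - 1) * exp (- (v * of_real t)) *
                 lerch_kernel v p (z * complex_of_real (exp (-t)))"
  obtain B where B: "\<And>t. t > 0 \<Longrightarrow> norm (lerch_kernel v p (z * of_real (exp (-t)))) \<le> B"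
    using lerch_kernel_bounded[OF z] by (metis centre_in_ball)
  have "(\<lambda>s. \<integral>t. ?f s t \<partial>halfline) holomorphic_on S"
  proof (rule holomorphic_integral[OF S])
    fix s assume s: "s \<in> S"
    \<comment> \<open>On the disc of radius \<open>d\<close> the real part of the exponent \<open>s + p\<close> varies between \<open>d\<close> and \<open>3 * d\<close>.\<close>
    define d where "d = (Re s + real p) / 2"
    have d: "d > 0" using s by (simp add: S_def d_def)
    let ?h = "\<lambda>t. (t powr (d - 1) * exp (- (Re v * t)) + t powr (3 * d - 1) * exp (- (Re v * t))) * B"
    have int: "integrable halfline ?h"
      by (intro integrable_mult_left Bochner_Integration.integrable_add integrable_Gamma_kernel_real)
         (use v d in auto)
    have le: "norm (?f x t) \<le> ?h t" if x: "x \<in> ball s d \<inter> S" and "t \<in> space halfline" for x t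
    proof -
      have t: "t > 0" using that by (simp add: space_restrict_space)
      have "Re (s - x) < d" "Re (x - s) < d"
        using x complex_Re_le_cmod[of "s - x"] complex_Re_le_cmod[of "x - s"]
        by (auto simp: dist_norm norm_minus_commute)
      hence "d - 1 \<le> Re x + real p - 1" "Re x + real p - 1 \<le> 3 * d - 1"
        by (simp_all add: d_def)
      hence "t powr (Re x + real p - 1) \<le> t powr (d - 1) + t powr (3 * d - 1)"
        using t by (intro powr_le_sum_of_endpoints)
      hence "norm (of_real t powr (x + of_nat p - 1) * exp (- (v * of_real t))) \<le>
               (t powr (d - 1) + t powr (3 * d - 1)) * exp (- (Re v * t))"
        using t by (simp add: norm_mult norm_powr_real_powr)
      thus ?thesis
        unfolding norm_mult[of "_ * _"] using B[OF t]
        by (intro mult_mono) (auto simp: algebra_simps intro: order_trans[OF norm_ge_zero])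
    qed
    show "\<exists>d>0. \<exists>h. integrable halfline h \<and>
        (\<forall>x\<in>ball s d \<inter> S. \<forall>t\<in>space halfline. norm (?f x t) \<le> h t)"
      by (intro exI[of _ d] exI[of _ ?h] conjI ballI d int le)
  qed (auto intro!: borel_measurable_lerch_integrand z holomorphic_intros simp: space_restrict_space)
  thus ?thesis
    unfolding lerch_integral_def S_def by (intro holomorphic_intros)
qed

text \<open>The kernel is expanded into its power series and integrated term by term; the factor
  \<open>(j + v) ^ p\<close> and the power \<open>(j + v) powr -(s + p)\<close> from the Gamma integral combine to
  \<open>(j + v) powr -s\<close>.\<close>

lemma lerch_integral_eq_series:
  assumes v: "Re v > 0" and s: "Re s + real p > 0" and z: "norm z < 1"
  shows "lerch_integral p z s v = lerch_series z s v"
proof -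
  define q where "q = s + of_nat p"
  have q: "Re q > 0" using s by (simp add: q_def)
  define c where "c = (\<lambda>j. z ^ j * (of_nat j + v) ^ p)"
  define g where "g = (\<lambda>j t. complex_of_real t powr (q - 1) * exp (- ((of_nat j + v) * of_real t)))"
  let ?f = "\<lambda>j t. c j * g j t"
  have int_g: "integrable halfline (g j)" for j
    unfolding g_def by (intro integrable_Gamma_kernel q) (use v in auto)
  define I where "I = (\<integral>t. norm (g 0 t) \<partial>halfline)"
  have g_le: "norm (g j t) \<le> norm (g 0 t)" if "t > 0" for j t
    using that by (simp add: g_def norm_mult mult_left_mono mult_right_mono)
  have sums_f: "(\<lambda>j. ?f j t) sums (of_real t powr (q - 1) * exp (- (v * of_real t)) *
                  lerch_kernel v p (z * of_real (exp (-t))))" if t: "t > 0" for t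
  proof -
    have "norm z * exp (-t) < 1 * 1"
      using z t by (intro mult_strict_mono) auto
    hence "norm (z * of_real (exp (-t))) < 1"
      by (simp add: norm_mult)
    note sums = sums_mult[OF lerch_kernel_sums[OF this],
        of "of_real t powr (q - 1) * exp (- (v * of_real t))"]
    have "exp (- ((of_nat j + v) * of_real t)) = exp (- (v * of_real t)) * of_real (exp (-t)) ^ j" for j
      by (simp add: exp_of_real [symmetric] exp_of_nat_mult [symmetric] exp_add [symmetric] algebra_simps
               del: exp_of_real)
    hence "?f j t = of_real t powr (q - 1) * exp (- (v * of_real t)) *
             ((of_nat j + v) ^ p * (z * of_real (exp (-t))) ^ j)" for j
      by (simp add: c_def g_def power_mult_distrib mult_ac)
    thus ?thesis using sums by presburger
  qed
  have ne: "of_nat j + v \<noteq> 0" for j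
    using v by (auto simp: complex_eq_iff)
  have summ_c: "summable (\<lambda>j. norm (c j))"
    using summable_shifted_powr[of z "- of_nat p" v] z ne by (simp add: c_def norm_mult powr_nat')
  have "(\<lambda>j. \<integral>t. ?f j t \<partial>halfline) sums (\<integral>t. (\<Sum>j. ?f j t) \<partial>halfline)"
  proof (rule sums_integral)
    show "integrable halfline (?f j)" for j
      by (intro integrable_mult_right int_g)
    show "AE t in halfline. summable (\<lambda>j. norm (?f j t))"
    proof (rule AE_I2)
      fix t assume "t \<in> space halfline"
      hence t: "t > 0" by (simp add: space_restrict_space)
      show "summable (\<lambda>j. norm (?f j t))"
        by (rule summable_comparison_test'[OF summable_mult2[OF summ_c, of "norm (g 0 t)"]])
           (use g_le[OF t] in \<open>auto simp: norm_mult intro!: mult_left_mono\<close>)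
    qed
    show "summable (\<lambda>j. \<integral>t. norm (?f j t) \<partial>halfline)"
    proof (rule summable_comparison_test'[OF summable_mult2[OF summ_c, of I]])
      fix j :: nat
      have "(\<integral>t. norm (g j t) \<partial>halfline) \<le> I"
        unfolding I_def by (intro integral_mono integrable_norm int_g g_le) (simp add: space_restrict_space)
      thus "norm (\<integral>t. norm (?f j t) \<partial>halfline) \<le> norm (c j) * I"
        by (simp add: norm_mult mult_left_mono abs_mult)
    qed
  qed
  also have "(\<integral>t. (\<Sum>j. ?f j t) \<partial>halfline) = (\<integral>t. of_real t powr (q - 1) * exp (- (v * of_real t)) *
                  lerch_kernel v p (z * of_real (exp (-t))) \<partial>halfline)"
    by (intro Bochner_Integration.integral_cong refl)
       (use sums_f in \<open>auto simp: space_restrict_space sums_iff\<close>)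
  finally have "(\<lambda>j. rGamma q * (\<integral>t. ?f j t \<partial>halfline)) sums lerch_integral p z s v"
    unfolding lerch_integral_def q_def by (rule sums_mult)
  also have "(\<lambda>j. rGamma q * (\<integral>t. ?f j t \<partial>halfline)) = (\<lambda>j. z ^ j * (of_nat j + v) powr (-s))"
  proof
    fix j
    have "(\<integral>t. ?f j t \<partial>halfline) = c j * (Gamma q * (of_nat j + v) powr (-q))"
      using Gamma_kernel_integral[OF q, of "of_nat j + v"] v by (simp add: g_def)
    also have "(of_nat j + v) powr (-q) = (of_nat j + v) powr (-s) / (of_nat j + v) ^ p"
      using ne[of j] by (simp add: q_def powr_diff powr_nat')
    finally show "rGamma q * (\<integral>t. ?f j t \<partial>halfline) = z ^ j * (of_nat j + v) powr (-s)"
      using ne[of j] q Gamma_eq_zero_iff[of q] by (auto simp: c_def rGamma_inverse_Gamma elim!: nonpos_Ints_cases)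
  qed
  finally show ?thesis
    using lerch_series_sums[of z s v] z by (auto dest: sums_unique2)
qed

text \<open>Radial approach from inside the disc, in the manner of Abel's theorem.\<close>

lemma lerch_integral_eq_series_circle:
  assumes v: "Re v > 0" and s: "Re s > 1" and z: "norm z = 1" "z \<noteq> 1"
  shows "lerch_integral p z s v = lerch_series z s v"
proof -
  have zs: "z \<in> slit_plane"
  proof
    assume "z \<in> complex_of_real ` {1..}"
    then obtain x where x: "z = of_real x" "x \<in> {1..}" by (rule imageE)
    hence "x = 1" using z(1) by simp
    thus False using x z(2) by simp
  qed
  let ?X = "\<lambda>n. of_real (1 - 1 / real (n + 2)) * z"
  have X: "norm (?X n) < 1" for n
    using z unfolding norm_mult norm_of_real by simp
  have XS: "?X n \<in> slit_plane" for n
    using X[of n] by (intro subsetD[OF ball_subset_slit_plane]) (simp only: mem_ball_0)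
  have "(\<lambda>n. complex_of_real (1 - 1 / real (n + 2))) \<longlonglongrightarrow> of_real 1"
    by (intro tendsto_of_real) real_asymp
  hence lim: "?X \<longlonglongrightarrow> z"
    using tendsto_mult_right[of _ 1 sequentially z] by simp
  have "(\<lambda>n. lerch_series (?X n) s v) \<longlonglongrightarrow> lerch_series z s v"
    by (rule continuous_on_tendsto_compose[OF continuous_on_lerch_series[OF s] lim])
       (use z X in \<open>auto intro!: always_eventually less_imp_le\<close>)
  moreover have "(\<lambda>n. lerch_integral p (?X n) s v) \<longlonglongrightarrow> lerch_integral p z s v"
  proof (rule continuous_on_tendsto_compose[OF _ lim zs])
    show "continuous_on slit_plane (\<lambda>z. lerch_integral p z s v)"
      using v s by (intro holomorphic_on_imp_continuous_on holomorphic_lerch_integral_z) auto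
    show "\<forall>\<^sub>F n in sequentially. ?X n \<in> slit_plane"
      by (intro always_eventually allI XS)
  qed
  moreover have "lerch_integral p (?X n) s v = lerch_series (?X n) s v" for n
    by (rule lerch_integral_eq_series) (use X s v in auto)
  ultimately show ?thesis
    using LIMSEQ_unique by simp
qed

text \<open>The integral needs \<open>Re v > 0\<close>; splitting off the first \<open>N\<close> terms of the series shifts \<open>v\<close> to
  \<open>v + N\<close>.\<close>

definition lerch_continuation :: "nat \<Rightarrow> nat \<Rightarrow> complex \<Rightarrow> complex \<Rightarrow> complex \<Rightarrow> complex" where
  "lerch_continuation N p z s v = (\<Sum>j<N. z ^ j * (of_nat j + v) powr (-s)) +
     z ^ N * lerch_integral p z s (v + of_nat N)"

lemma lerch_phi_eq_series:
  assumes "norm z < 1 \<or> norm z = 1 \<and> Re s > 1"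
  shows "lerch_phi z s v = lerch_series z s v"
  using assms by (auto simp: lerch_phi_def)

text \<open>By uniqueness of the continuation all admissible \<open>N\<close> and \<open>p\<close> give the same value. This allows \<open>p\<close> to grow when \<open>s\<close> varies over the whole plane.\<close>

lemma lerch_phi_eq_continuation:
  assumes z: "z \<in> slit_plane" and N: "Re v + real N > 0" and p: "Re s + real p > 0"
  shows "lerch_phi z s v = lerch_continuation N p z s v"
proof -
  have in_ball: "lerch_continuation N p u s v = lerch_series u s v" if "u \<in> ball 0 1" for u
    using that N p lerch_series_shift[of u s v N] lerch_integral_eq_series[of "v + of_nat N" s p u]
    by (auto simp: lerch_continuation_def)
  have z1: "z \<noteq> 1" using z by force
  show ?thesis
  proof (cases "norm z < 1 \<or> norm z = 1 \<and> Re s > 1")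
    case True
    have "lerch_integral p z s (v + of_nat N) = lerch_series z s (v + of_nat N)"
      using True N p z1 lerch_integral_eq_series[of "v + of_nat N" s p z]
        lerch_integral_eq_series_circle[of "v + of_nat N" s z p] by auto
    thus ?thesis
      using lerch_series_shift[OF True, of v N]
      by (simp add: lerch_phi_eq_series[OF True] lerch_continuation_def)
  next
    case False
    hence "lerch_phi z s v = continuation (\<lambda>u. lerch_series u s v) (ball 0 1) slit_plane z"
      using z1 by (auto simp: lerch_phi_def)
    also have "\<dots> = lerch_continuation N p z s v"
    proof (rule continuation_eqI[OF open_slit_plane connected_slit_plane])
      show "(\<lambda>z. lerch_continuation N p z s v) holomorphic_on slit_plane"
        unfolding lerch_continuation_def
        by (intro holomorphic_intros holomorphic_lerch_integral_z) (use N p in auto)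
    qed (use in_ball ball_subset_slit_plane z in auto)
    finally show ?thesis .
  qed
qed

lemma ex_nat_add_pos: "\<exists>N. x + real N > 0"
proof -
  obtain N where "- x < real N" using reals_Archimedean2 by blast
  thus ?thesis by (intro exI[of _ N]) linarith
qed

lemma holomorphic_lerch_phi_z: "(\<lambda>z. lerch_phi z s v) holomorphic_on slit_plane"
proof -
  obtain N p where N: "Re v + real N > 0" and p: "Re s + real p > 0"
    using ex_nat_add_pos by meson
  have "(\<lambda>z. lerch_continuation N p z s v) holomorphic_on slit_plane"
    unfolding lerch_continuation_def
    by (intro holomorphic_intros holomorphic_lerch_integral_z) (use N p in auto)
  thus ?thesis
    by (rule holomorphic_transform) (rule lerch_phi_eq_continuation[OF _ N p, symmetric])
qed

text \<open>For each fixed \<open>z\<close> off the cut the Lerch function is entire in \<open>s\<close>. The definition continues in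
  \<open>z\<close> separately for every \<open>s\<close>, so this regularity has to be read off from the integral.\<close>

lemma holomorphic_lerch_phi_s:
  assumes z: "z \<in> slit_plane"
  shows "(\<lambda>s. lerch_phi z s v) holomorphic_on UNIV"
proof -
  obtain N where N: "Re v + real N > 0"
    using ex_nat_add_pos by meson
  have "(\<lambda>s. lerch_phi z s v) holomorphic_on {s. Re s > - real p}" for p
  proof -
    have "(\<lambda>s. lerch_continuation N p z s v) holomorphic_on {s. Re s > - real p}"
      unfolding lerch_continuation_def
      by (intro holomorphic_intros holomorphic_lerch_integral_s z) (use N in auto)
    thus ?thesis
      by (rule holomorphic_transform) (rule lerch_phi_eq_continuation[OF z N, symmetric], simp)
  qed
  hence "(\<lambda>s. lerch_phi z s v) holomorphic_on (\<Union>p. {s. Re s > - real p})"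
    by (intro holomorphic_on_UN_open open_halfspace_Re_gt)
  moreover have "(\<Union>p. {s. Re s > - real p}) = UNIV"
  proof -
    have "\<exists>p. Re s > - real p" for s :: complex
    proof -
      obtain p where "Re s + real p > 0" using ex_nat_add_pos by meson
      thus ?thesis by (intro exI[of _ p]) linarith
    qed
    thus ?thesis by auto
  qed
  ultimately show ?thesis by simp
qed

section \<open>Continuation of the Hurwitz zeta function in \<open>s\<close>\<close>

lemma fact_gbinomial_Suc:
  "fact (Suc i) * (a gchoose Suc i) = fact i * (a gchoose i) * (a - of_nat i :: complex)"
  using gbinomial_mult_1'[of a i] by (simp add: algebra_simps)

text \<open>Taylor expansion of \<open>x powr a\<close> from \<open>u\<close> to \<open>u + 1\<close>. Moving to the right inside the right half-plane
  increases the modulus, so the power of the modulus in the remainder term, whose exponent is not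
  positive, is largest at \<open>u\<close>.\<close>

lemma powr_succ_Taylor:
  fixes u a :: complex
  assumes u: "Re u > 0" and a: "Re a \<le> real (n + 1)"
  shows "norm ((u + 1) powr a - (\<Sum>i\<le>n. (a gchoose i) * u powr (a - of_nat i))) \<le>
           real (n + 1) * norm (a gchoose (n + 1)) * exp (pi * \<bar>Im a\<bar>) * norm u powr (Re a - real (n + 1))"
proof -
  define f where "f = (\<lambda>i x. fact i * (a gchoose i) * x powr (a - of_nat i))"
  have seg: "Re x > 0 \<and> norm u \<le> norm x" if x: "x \<in> closed_segment u (u + 1)" for x
  proof -
    obtain t where t: "0 \<le> t" "x = u + of_real t"
      using x by (auto simp: in_segment scaleR_conv_of_real algebra_simps)
    have "(Re u)\<^sup>2 \<le> (Re u + t)\<^sup>2"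
      using u t by (intro power_mono) auto
    thus ?thesis using t u by (auto simp: norm_complex_def)
  qed
  have "norm (f 0 (u + 1) - (\<Sum>i\<le>n. f i u * ((u + 1) - u) ^ i / fact i)) \<le>
          (norm (fact (Suc n) * (a gchoose (Suc n))) * (norm u powr (Re a - real (Suc n)) * exp (pi * \<bar>Im a\<bar>)))
            * norm ((u + 1) - u) ^ Suc n / fact n"
  proof (rule complex_Taylor[of "closed_segment u (u + 1)"])
    fix i x assume x: "x \<in> closed_segment u (u + 1)"
    have "x \<notin> \<real>\<^sub>\<le>\<^sub>0" using seg[OF x] by (auto simp: complex_nonpos_Reals_iff)
    hence "(f i has_field_derivative fact i * (a gchoose i) * ((a - of_nat i) * x powr (a - of_nat i - 1)))
            (at x within closed_segment u (u + 1))"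
      unfolding f_def by (auto intro!: derivative_eq_intros)
    thus "(f i has_field_derivative f (Suc i) x) (at x within closed_segment u (u + 1))"
      unfolding f_def fact_gbinomial_Suc by (simp add: algebra_simps)
  next
    fix x assume x: "x \<in> closed_segment u (u + 1)"
    have u0: "norm u > 0" using u by auto
    have "norm (x powr (a - of_nat (Suc n))) \<le>
            norm x powr Re (a - of_nat (Suc n)) * exp (pi * \<bar>Im (a - of_nat (Suc n))\<bar>)"
      by (rule norm_powr_le)
    also have "\<dots> \<le> norm u powr (Re a - real (Suc n)) * exp (pi * \<bar>Im a\<bar>)"
      using a seg[OF x] u0 by (auto intro!: mult_right_mono powr_mono2')
    finally show "norm (f (Suc n) x) \<le> norm (fact (Suc n) * (a gchoose (Suc n))) *
        (norm u powr (Re a - real (Suc n)) * exp (pi * \<bar>Im a\<bar>))"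
      unfolding f_def norm_mult[of _ "_ powr _"] by (intro mult_left_mono) auto
  qed auto
  also have "\<dots> = real (n + 1) * norm (a gchoose (n + 1)) * exp (pi * \<bar>Im a\<bar>) * norm u powr (Re a - real (n + 1))"
    unfolding norm_mult norm_fact by simp
  finally show ?thesis by (simp add: f_def)
qed

lemma holomorphic_gbinomial: "(\<lambda>s::complex. (1 - s) gchoose k) holomorphic_on A"
  unfolding gbinomial_prod_rev by (intro holomorphic_intros) (rule fact_nonzero)

lemma continuous_imp_bounded_on_ball:
  fixes f :: "complex \<Rightarrow> complex"
  assumes "continuous_on UNIV f"
  shows "\<exists>B\<ge>0. \<forall>x\<in>ball s d. norm (f x) \<le> B"
proof -
  have "compact (f ` cball s d)"
    using assms by (intro compact_continuous_image) (auto intro: continuous_on_subset)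
  then obtain B where "B > 0" "\<forall>y\<in>f ` cball s d. norm y \<le> B"
    using compact_imp_bounded bounded_pos by metis
  thus ?thesis by (intro exI[of _ B]) auto
qed

text \<open>The sum over \<open>j\<close> of \<open>(j + 1 + v) powr (1 - s) - (j + v) powr (1 - s)\<close> telescopes to
  \<open>- (v powr (1 - s))\<close>. Expanding every difference by Taylor's formula instead produces
  \<open>(1 - s) * \<zeta>(s, v)\<close>, binomial multiples of \<open>\<zeta>(s + 1, v), \<dots>, \<zeta>(s + p, v)\<close>, and remainders \<open>R p j s\<close>
  of order \<open>j powr (- Re s - p - 1)\<close>, whose sum therefore converges for \<open>Re s > -p\<close>.\<close>

lemma hurwitz_recurrence:
  fixes v :: complex
  assumes v: "Re v > 0"
  defines "R \<equiv> \<lambda>p j s. (of_nat (Suc j) + v) powr (1 - s) -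
             (\<Sum>i\<le>Suc p. ((1 - s) gchoose i) * (of_nat j + v) powr (1 - s - of_nat i))"
  shows "(\<lambda>s. \<Sum>j. R p j s) holomorphic_on {s. Re s > - real p}"
    and "Re s > 1 \<Longrightarrow> (s - 1) * lerch_series 1 s v = v powr (1 - s)
           + (\<Sum>l=1..p. ((1 - s) gchoose Suc l) * lerch_series 1 (s + of_nat l) v) + (\<Sum>j. R p j s)"
proof -
  define S where "S = {s. Re s > - real p}"
  have S: "open S" unfolding S_def by (rule open_halfspace_Re_gt)
  have bound: "\<exists>d>0. \<exists>M. summable M \<and>
      (\<forall>\<^sub>F j in sequentially. \<forall>y\<in>ball x d \<inter> S. norm (R p j y) \<le> M j)" if x: "x \<in> S" for x
  proof -
    define d where "d = (Re x + real p) / 2"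
    have d: "d > 0" using x by (simp add: d_def S_def)
    define K where "K = (\<lambda>s. of_real (real (p + 2) * exp (pi * \<bar>Im (1 - s)\<bar>)) * ((1 - s) gchoose (p + 2)))"
    have "continuous_on UNIV K"
      unfolding K_def by (intro continuous_intros holomorphic_on_imp_continuous_on holomorphic_gbinomial)
    then obtain B where B: "B \<ge> 0" "\<forall>y\<in>ball x d. norm (K y) \<le> B"
      using continuous_imp_bounded_on_ball by meson
    define M where "M = (\<lambda>j. B * real j powr (-1 - d))"
    have "norm (R p j y) \<le> M j" if j: "j \<ge> 1" and y: "y \<in> ball x d" for j y
    proof -
      have "Re (x - y) < d"
        using y complex_Re_le_cmod[of "x - y"] by (auto simp: dist_norm)
      hence re: "- Re y - real p \<le> -d"
        by (simp add: d_def field_simps)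
      have u: "Re (of_nat j + v) > 0" using v by simp
      have uj: "real j \<le> norm (of_nat j + v)"
        using complex_Re_le_cmod[of "of_nat j + v"] v by simp
      have suc: "of_nat (Suc j) + v = of_nat j + v + 1" by simp
      have "norm (R p j y) \<le> real (Suc p + 1) * norm ((1 - y) gchoose (Suc p + 1)) *
              exp (pi * \<bar>Im (1 - y)\<bar>) * norm (of_nat j + v) powr (Re (1 - y) - real (Suc p + 1))"
        unfolding R_def suc by (rule powr_succ_Taylor[OF u]) (use re d in simp)
      also have "\<dots> = norm (K y) * norm (of_nat j + v) powr (- Re y - real p - 1)"
      proof -
        have "norm (K y) = real (Suc p + 1) * exp (pi * \<bar>Im (1 - y)\<bar>) * norm ((1 - y) gchoose (Suc p + 1))"
          unfolding K_def norm_mult norm_of_real by (simp add: abs_mult)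
        moreover have "Re (1 - y) - real (Suc p + 1) = - Re y - real p - 1"
          by simp
        ultimately show ?thesis by (simp only: mult_ac)
      qed
      also have "\<dots> \<le> B * real j powr (- Re y - real p - 1)"
        using B y j uj re d by (intro mult_mono powr_mono2') auto
      also have "\<dots> \<le> B * real j powr (-1 - d)"
        using B j re by (intro mult_left_mono powr_mono) auto
      finally show ?thesis by (simp add: M_def)
    qed
    hence "\<forall>\<^sub>F j in sequentially. \<forall>y\<in>ball x d \<inter> S. norm (R p j y) \<le> M j"
      by (intro eventually_mono[OF eventually_ge_at_top[of 1]] ballI) auto
    moreover have "summable M"
      unfolding M_def using d by (intro summable_mult) (simp add: summable_real_powr_iff)
    ultimately show ?thesis using d by blast
  qed
  have holR: "R p j holomorphic_on S" for j
    unfolding R_def by (intro holomorphic_intros holomorphic_gbinomial)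
  show "(\<lambda>s. \<Sum>j. R p j s) holomorphic_on {s. Re s > - real p}"
    using holomorphic_suminf(1)[OF S holR bound] by (simp add: S_def)

  assume s: "Re s > 1"
  define u where "u = (\<lambda>j. complex_of_nat j + v)"
  have summR: "(\<lambda>j. R p j s) sums (\<Sum>j. R p j s)"
    using holomorphic_suminf(2)[OF S holR bound, of s] s by (simp add: S_def summable_sums)
  have ser: "(\<lambda>j. u j powr (-(s + of_nat l))) sums lerch_series 1 (s + of_nat l) v" for l
    using lerch_series_sums[of 1 "s + of_nat l" v] s by (simp add: u_def)
  have "(\<lambda>j. u j powr (1 - s)) \<longlonglongrightarrow> 0"
  proof (rule Lim_null_comparison)
    define C where "C = 2 powr \<bar>Re (s - 1)\<bar> * exp (pi * \<bar>Im (s - 1)\<bar>)"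
    show "\<forall>\<^sub>F j in sequentially. norm (u j powr (1 - s)) \<le> C * real j powr (- Re (s - 1))"
      using eventually_shifted_powr_bound[of "Re (s - 1)" "\<bar>Im (s - 1)\<bar>" v]
      by eventually_elim (auto simp: C_def u_def dest!: spec[of _ "s - 1"])
    have "(\<lambda>j. real j powr (- Re (s - 1))) \<longlonglongrightarrow> 0"
      by (rule tendsto_neg_powr) (use s in \<open>auto intro: filterlim_real_sequentially\<close>)
    thus "(\<lambda>j. C * real j powr (- Re (s - 1))) \<longlonglongrightarrow> 0"
      by (rule tendsto_mult_right_zero)
  qed
  from telescope_sums[OF this] have "(\<lambda>j. u (Suc j) powr (1 - s) - u j powr (1 - s)) sums - (v powr (1 - s))"
    by (simp add: u_def)
  moreover have "(\<lambda>j. u (Suc j) powr (1 - s) - u j powr (1 - s)) =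
      (\<lambda>j. (\<Sum>l\<le>p. ((1 - s) gchoose Suc l) * u j powr (-(s + of_nat l))) + R p j s)"
  proof
    fix j
    have "1 - s - of_nat (Suc l) = -(s + of_nat l)" for l
      by simp
    hence "R p j s = u (Suc j) powr (1 - s) - (u j powr (1 - s) +
             (\<Sum>l\<le>p. ((1 - s) gchoose Suc l) * u j powr (-(s + of_nat l))))"
      unfolding R_def u_def by (subst sum.atMost_Suc_shift) simp
    thus "u (Suc j) powr (1 - s) - u j powr (1 - s) =
            (\<Sum>l\<le>p. ((1 - s) gchoose Suc l) * u j powr (-(s + of_nat l))) + R p j s"
      by (simp add: algebra_simps)
  qed
  moreover have "(\<lambda>j. (\<Sum>l\<le>p. ((1 - s) gchoose Suc l) * u j powr (-(s + of_nat l))) + R p j s) sums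
      ((\<Sum>l\<le>p. ((1 - s) gchoose Suc l) * lerch_series 1 (s + of_nat l) v) + (\<Sum>j. R p j s))"
    by (intro sums_add sums_sum sums_mult ser summR)
  ultimately have "- (v powr (1 - s)) =
      (\<Sum>l\<le>p. ((1 - s) gchoose Suc l) * lerch_series 1 (s + of_nat l) v) + (\<Sum>j. R p j s)"
    by (simp add: sums_unique2)
  also have "(\<Sum>l\<le>p. ((1 - s) gchoose Suc l) * lerch_series 1 (s + of_nat l) v) =
      (1 - s) * lerch_series 1 s v + (\<Sum>l=1..p. ((1 - s) gchoose Suc l) * lerch_series 1 (s + of_nat l) v)"
    by (simp add: atMost_atLeast0 sum.atLeast_Suc_atMost)
  finally show "(s - 1) * lerch_series 1 s v = v powr (1 - s)
           + (\<Sum>l=1..p. ((1 - s) gchoose Suc l) * lerch_series 1 (s + of_nat l) v) + (\<Sum>j. R p j s)"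
    by (simp add: algebra_simps)
qed

text \<open>Each use of the recurrence enlarges the half-plane by 1. The function continued is
  \<open>(s - 1) * \<zeta>(s, v)\<close>, which has no pole at 1. The poles of the shifted terms at \<open>s = 1 - l\<close> do no harm
  either, since the coefficient \<open>(1 - s) gchoose Suc l\<close> contains the factor \<open>1 - s - l\<close>.\<close>

lemma hurwitz_halfplane_continuation:
  assumes v: "Re v > 0"
  shows "\<exists>E. E holomorphic_on {s. Re s > 1 - real p} \<and>
             (\<forall>s. Re s > 1 \<longrightarrow> E s = (s - 1) * lerch_series 1 s v)"
proof (induction p)
  case 0
  have "(\<lambda>s. (s - 1) * lerch_series 1 s v) holomorphic_on {s. Re s > 1}"
    by (intro holomorphic_intros holomorphic_lerch_series) auto
  thus ?case by (intro exI[of _ "\<lambda>s. (s - 1) * lerch_series 1 s v"]) simp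
next
  case (Suc p)
  then obtain E where E: "E holomorphic_on {s. Re s > 1 - real p}"
      "\<And>s. Re s > 1 \<Longrightarrow> E s = (s - 1) * lerch_series 1 s v"
    by blast
  obtain T where T: "T holomorphic_on {s. Re s > - real p}"
    "\<And>s. Re s > 1 \<Longrightarrow> (s - 1) * lerch_series 1 s v = v powr (1 - s)
           + (\<Sum>l=1..p. ((1 - s) gchoose Suc l) * lerch_series 1 (s + of_nat l) v) + T s"
    by (rule that[OF hurwitz_recurrence(1)[OF v, where p = p] hurwitz_recurrence(2)[OF v, where p = p]])
  \<comment> \<open>As \<open>(1 - s) gchoose Suc l = - ((1 - s) gchoose l) * (s + l - 1) / (l + 1)\<close>, the \<open>l\<close>-th term is
    the negative of the one in the recurrence.\<close>
  define E' where "E' = (\<lambda>s. v powr (1 - s) -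
      (\<Sum>l=1..p. ((1 - s) gchoose l) / of_nat (Suc l) * E (s + of_nat l)) + T s)"
  have "E' holomorphic_on {s. Re s > - real p}"
  proof -
    have "(\<lambda>s. E (s + of_nat l)) holomorphic_on {s. Re s > - real p}" if "l \<in> {1..p}" for l
      by (rule holomorphic_on_compose_gen[OF _ E(1), unfolded o_def])
         (use that in \<open>auto intro!: holomorphic_intros\<close>)
    thus ?thesis
      unfolding E'_def by (intro holomorphic_intros holomorphic_gbinomial T) auto
  qed
  moreover have "E' s = (s - 1) * lerch_series 1 s v" if s: "Re s > 1" for s
  proof -
    have "((1 - s) gchoose Suc l) * lerch_series 1 (s + of_nat l) v =
            - (((1 - s) gchoose l) / of_nat (Suc l) * E (s + of_nat l))" for l
    proof -
      have "((1 - s) gchoose Suc l) = ((1 - s) gchoose l) * (- (s + of_nat l - 1)) / of_nat (Suc l)"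
        using gbinomial_mult_1'[of "1 - s" l]
        by (subst nonzero_eq_divide_eq[OF of_nat_neq_0]) (simp add: algebra_simps)
      moreover have "E (s + of_nat l) = (s + of_nat l - 1) * lerch_series 1 (s + of_nat l) v"
        by (rule E(2)) (use s in auto)
      moreover have "g * (- c) / d * L = - (g / d * (c * L))" for g c d L :: complex
        by simp
      ultimately show ?thesis by (simp only:)
    qed
    thus ?thesis
      using T(2)[OF s] by (simp add: E'_def sum_negf)
  qed
  ultimately show ?case
    by (intro exI[of _ E']) auto
qed

lemma holomorphic_glue_increasing:
  fixes U :: "nat \<Rightarrow> complex set"
  assumes U: "\<And>p. open (U p)" "\<And>p. connected (U p)" "U 0 \<noteq> {}" and mono: "mono U"
    and ex: "\<And>p. \<exists>g. g holomorphic_on U p \<and> (\<forall>x\<in>U 0. g x = f x)"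
  shows "\<exists>g. g holomorphic_on (\<Union>p. U p) \<and> (\<forall>x\<in>U 0. g x = f x)"
proof -
  from ex obtain g where g: "\<And>p. g p holomorphic_on U p" "\<And>p x. x \<in> U 0 \<Longrightarrow> g p x = f x"
    by metis
  \<comment> \<open>Any \<open>p\<close> with \<open>x\<close> in \<open>U p\<close> yields the same value, by uniqueness of continuation from \<open>U 0\<close>.\<close>
  define G where "G = (\<lambda>x. g (LEAST p. x \<in> U p) x)"
  have G_eq: "G x = g p x" if x: "x \<in> U p" for x p
  proof -
    define q where "q = (LEAST p. x \<in> U p)"
    have q: "q \<le> p" "x \<in> U q"
      using x unfolding q_def by (auto intro: Least_le LeastI)
    have sub: "U 0 \<subseteq> U q" "U q \<subseteq> U p"
      using q(1) mono by (auto simp: mono_def)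
    have "g q x = g p x"
      by (rule analytic_continuation_open[of "U 0" "U q"])
         (use U sub q(2) in \<open>simp_all add: g holomorphic_on_subset[OF g(1)]\<close>)
    thus ?thesis by (simp add: G_def q_def)
  qed
  have "G holomorphic_on U p" for p
    using g(1)[of p] by (rule holomorphic_transform) (simp add: G_eq)
  hence "G holomorphic_on (\<Union>p. U p)"
    by (intro holomorphic_on_UN_open U)
  moreover have "\<forall>x\<in>U 0. G x = f x"
    using G_eq[of _ 0] g(2) by auto
  ultimately show ?thesis by blast
qed

lemma hurwitz_continuation_exists:
  "\<exists>Z. Z holomorphic_on - {1} \<and> (\<forall>s. Re s > 1 \<longrightarrow> Z s = lerch_series 1 s v)"
proof -
  obtain N where "Re v + real N > 0"
    using ex_nat_add_pos by meson
  hence N: "Re (v + of_nat N) > 0" by simp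
  have "\<exists>E. E holomorphic_on (\<Union>p. {s. Re s > 1 - real p}) \<and>
          (\<forall>s\<in>{s. Re s > 1 - real 0}. E s = (s - 1) * lerch_series 1 s (v + of_nat N))"
  proof (rule holomorphic_glue_increasing)
    show "{s. Re s > 1 - real 0} \<noteq> {}"
      by (auto intro!: exI[of _ 2])
    show "\<exists>g. g holomorphic_on {s. Re s > 1 - real p} \<and>
        (\<forall>x\<in>{s. Re s > 1 - real 0}. g x = (x - 1) * lerch_series 1 x (v + of_nat N))" for p
      using hurwitz_halfplane_continuation[OF N, of p] by simp
  qed (auto simp: open_halfspace_Re_gt mono_def intro: convex_connected convex_halfspace_Re_gt)
  moreover have "(\<Union>p. {s. Re s > 1 - real p}) = UNIV"
  proof -
    have "\<exists>p. Re s > 1 - real p" for s :: complex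
      using ex_nat_add_pos[of "Re s - 1"] by (simp add: algebra_simps)
    thus ?thesis by auto
  qed
  ultimately obtain E where E: "E holomorphic_on UNIV"
      "\<And>s. Re s > 1 \<Longrightarrow> E s = (s - 1) * lerch_series 1 s (v + of_nat N)"
    by auto
  define Z where "Z = (\<lambda>s. (\<Sum>j<N. (of_nat j + v) powr (-s)) + E s / (s - 1))"
  have "Z holomorphic_on - {1}"
    unfolding Z_def using E(1) by (intro holomorphic_intros) (auto intro: holomorphic_on_subset)
  moreover have "Z s = lerch_series 1 s v" if "Re s > 1" for s
    using that E(2)[OF that] lerch_series_shift[of 1 s v N] by (auto simp: Z_def)
  ultimately show ?thesis by blast
qed

lemma holomorphic_lerch_phi_1: "(\<lambda>s. lerch_phi 1 s v) holomorphic_on - {1}"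
proof -
  obtain Z where Z: "Z holomorphic_on - {1}" "\<And>s. Re s > 1 \<Longrightarrow> Z s = lerch_series 1 s v"
    using hurwitz_continuation_exists by blast
  have "Z s = lerch_phi 1 s v" if s: "s \<in> - {1}" for s
  proof (cases "Re s > 1")
    case True
    thus ?thesis using Z(2)[OF True] by (simp add: lerch_phi_eq_series)
  next
    case False
    have "hurwitz_zeta s v = Z s"
      unfolding hurwitz_zeta_def
      by (intro continuation_eqI Z s)
         (auto simp: open_halfspace_Re_gt intro!: connected_punctured_universe exI[of _ 2])
    thus ?thesis using False by (simp add: lerch_phi_def)
  qed
  with Z(1) show ?thesis by (rule holomorphic_transform)
qed

section \<open>The multiplication formula\<close>

text \<open>The region of all \<open>w\<close> whose \<open>n\<close>-th power avoids the cut is star-shaped about 0, because \<open>w\<close> and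
  \<open>w ^ n\<close> contract to 0 along rays simultaneously. This is why no monodromy arises when the
  multiplication formula is continued in \<open>w\<close>, although \<open>w \<mapsto> w ^ n\<close> winds around the origin.\<close>

lemma power_slit_plane_domain:
  fixes n :: nat
  assumes "n > 0"
  defines "W \<equiv> {w :: complex. w ^ n \<in> slit_plane}"
  shows "open W" "connected W" "ball 0 1 \<subseteq> W" "W \<subseteq> slit_plane"
proof -
  have "open ((\<lambda>w::complex. w ^ n) -` slit_plane)"
    by (intro open_vimage open_slit_plane continuous_intros)
  thus "open W" by (simp add: W_def vimage_def)
  have scale: "w * of_real t \<in> W" if w: "w \<in> W" and t: "0 \<le> t" "t \<le> 1" for w t
  proof -
    have "w ^ n * of_real (t ^ n) \<in> slit_plane"
      using w t by (intro slit_plane_mult power_le_one zero_le_power) (simp_all add: W_def)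
    thus ?thesis by (simp add: W_def power_mult_distrib)
  qed
  have "starlike W"
    unfolding starlike_def
  proof (intro bexI[of _ 0] ballI subsetI)
    fix x z assume x: "x \<in> W" and z: "z \<in> closed_segment 0 x"
    obtain t where t: "0 \<le> t" "t \<le> 1" "z = (1 - t) *\<^sub>R 0 + t *\<^sub>R x"
      using z unfolding in_segment by blast
    hence "z = x * of_real t"
      by (simp add: scaleR_conv_of_real)
    thus "z \<in> W"
      using scale[OF x t(1,2)] by simp
  qed (use assms(1) in \<open>auto simp: W_def power_0_left\<close>)
  thus "connected W" by (rule starlike_imp_connected)
  show "ball 0 1 \<subseteq> W"
  proof
    fix w :: complex assume "w \<in> ball 0 1"
    hence "w ^ n \<in> ball 0 1"
      using assms(1) by (simp add: norm_power power_less_one_iff)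
    thus "w \<in> W"
      using ball_subset_slit_plane unfolding W_def by blast
  qed
  show "W \<subseteq> slit_plane"
  proof
    fix w assume w: "w \<in> W"
    show "w \<in> slit_plane"
    proof
      assume "w \<in> complex_of_real ` {1..}"
      then obtain x where x: "w = of_real x" "x \<in> {1..}" by (rule imageE)
      hence "w ^ n = of_real (x ^ n)" "x ^ n \<in> {1..}" by (auto simp: one_le_power)
      hence "w ^ n \<in> complex_of_real ` {1..}" by (rule image_eqI)
      thus False using w by (simp add: W_def)
    qed
  qed
qed

lemma holomorphic_lerch_phi_s_punctured:
  assumes "z \<in> slit_plane \<or> z = 1"
  shows "(\<lambda>s. lerch_phi z s v) holomorphic_on - {1}"
  using assms holomorphic_lerch_phi_1 holomorphic_on_subset[OF holomorphic_lerch_phi_s] by blast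

text \<open>Both sides agree where the series converge. If \<open>w ^ n\<close> is off the cut, the identity continues in
  \<open>w\<close> from the unit disc for fixed \<open>s\<close>. If \<open>w ^ n = 1\<close>, the right side consists of Hurwitz zeta values,
  which are not limits of values off the cut when \<open>Re s \<le> 1\<close>; then \<open>w\<close> is fixed and the identity
  continues in \<open>s\<close> from \<open>Re s > 1\<close>. At a non-positive integer \<open>v\<close> the principal
  power of 0 has the value 0, so that the singular terms vanish on both sides.\<close>

lemma lerch_phi_multiplication:
  assumes n: "n > 0" and w: "w ^ n \<notin> complex_of_real ` {1<..}" and s: "w ^ n = 1 \<Longrightarrow> s \<noteq> 1"
  shows "lerch_phi w s v =
           of_nat n powr (-s) * (\<Sum>r<n. w ^ r * lerch_phi (w ^ n) s ((v + of_nat r) / of_nat n))"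
proof -
  define F where "F = (\<lambda>w s. of_nat n powr (-s) *
                    (\<Sum>r<n. w ^ r * lerch_phi (w ^ n) s ((v + of_nat r) / of_nat n)))"
  have series: "lerch_phi w s v = F w s" if "norm w < 1 \<or> norm w = 1 \<and> Re s > 1" for w s
  proof -
    have "norm (w ^ n) < 1 \<or> norm (w ^ n) = 1 \<and> Re s > 1"
      using that n by (auto simp: norm_power power_less_one_iff)
    thus ?thesis
      using lerch_series_multiplication[OF that n, of v] that
      by (simp add: F_def lerch_phi_eq_series)
  qed
  show ?thesis
  proof (cases "w ^ n = 1")
    case False
    have "w ^ n \<in> slit_plane"
    proof
      assume "w ^ n \<in> complex_of_real ` {1..}"
      then obtain x where x: "w ^ n = of_real x" "x \<in> {1..}" by (rule imageE)
      hence "x \<noteq> 1" using False by auto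
      hence "w ^ n \<in> complex_of_real ` {1<..}" using x by (intro image_eqI[of _ _ x]) auto
      thus False using w by blast
    qed
    define W where "W = {w :: complex. w ^ n \<in> slit_plane}"
    note W = power_slit_plane_domain[OF n, folded W_def]
    have "(\<lambda>w. lerch_phi (w ^ n) s v') holomorphic_on W" for v'
      by (rule holomorphic_on_compose_gen[OF _ holomorphic_lerch_phi_z, unfolded o_def])
         (auto intro!: holomorphic_intros simp: W_def simp del: Compl_iff)
    hence hol_F: "(\<lambda>w. F w s) holomorphic_on W"
      unfolding F_def by (intro holomorphic_intros)
    have hol: "(\<lambda>w. lerch_phi w s v) holomorphic_on W"
      by (rule holomorphic_on_subset[OF holomorphic_lerch_phi_z W(4)])
    have "w \<in> W"
      unfolding W_def using \<open>w ^ n \<in> slit_plane\<close> by (rule CollectI)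
    have "lerch_phi w s v = F w s"
    proof (rule analytic_continuation_open[OF _ W(1) _ W(2) W(3) hol hol_F _ \<open>w \<in> W\<close>])
      show "lerch_phi u s v = F u s" if "u \<in> ball 0 1" for u
        using that by (intro series) simp
    qed simp_all
    thus ?thesis by (simp add: F_def)
  next
    case True
    have norm_w: "norm w = 1"
      using True n by (metis norm_one norm_power norm_ge_zero power_eq_1_iff less_numeral_extra(3))
    have dom: "w \<in> slit_plane \<or> w = 1"
    proof (rule disjCI, rule ComplI)
      assume "w \<noteq> 1" "w \<in> complex_of_real ` {1..}"
      from this(2) obtain x where "w = of_real x" "x \<in> {1..}" by (rule imageE)
      with norm_w \<open>w \<noteq> 1\<close> show False by simp
    qed
    have "lerch_phi w s v = F w s"
    proof (rule analytic_continuation_open[of "{s. Re s > 1}" "- {1}" "\<lambda>s. lerch_phi w s v" "F w"])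
      show "F w holomorphic_on - {1}"
        unfolding F_def True by (intro holomorphic_intros holomorphic_lerch_phi_1)
      show "(\<lambda>s. lerch_phi w s v) holomorphic_on - {1}"
        by (rule holomorphic_lerch_phi_s_punctured[OF dom])
    qed (use s[OF True] series norm_w in
           \<open>auto simp: open_halfspace_Re_gt intro!: connected_punctured_universe exI[of _ 2]\<close>)
    thus ?thesis by (simp add: F_def)
  qed
qed

theorem theorem4p130:
  fixes n :: nat and k m a t :: complex
  assumes "n > 0"
    and "\<And>r. r < n \<Longrightarrow> lerch_defined (exp (\<i> * m * of_real pi)) (-k)
            (a - (2 * of_real pi * of_nat r + t) / (2 * of_nat n * of_real pi) + 1)"
    and "\<And>r. r < n \<Longrightarrow> lerch_defined (exp (\<i> * m * of_real pi)) (-k)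
            (a + (2 * of_real pi * of_nat r + t) / (2 * of_nat n * of_real pi))"
    and "lerch_defined (exp (\<i> * m * of_real pi / of_nat n)) (-k)
            (a * of_nat n - t / (2 * of_real pi) + 1)"
    and "lerch_defined (exp (\<i> * m * of_real pi / of_nat n)) (-k)
            (a * of_nat n + t / (2 * of_real pi))"
  shows "(\<Sum>r<n. exp (- (\<i> * of_real pi * m * of_nat r / of_nat n)) *
            ((-1) powr m *
               lerch_phi (exp (\<i> * m * of_real pi)) (-k)
                 (a - (2 * of_real pi * of_nat r + t) / (2 * of_nat n * of_real pi) + 1)
             + exp (\<i> * m * (2 * of_real pi * of_nat r + t) / of_nat n) *
               lerch_phi (exp (\<i> * m * of_real pi)) (-k)
                 (a + (2 * of_real pi * of_nat r + t) / (2 * of_nat n * of_real pi))))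
       = of_nat n powr (-k) *
           (exp (\<i> * of_real pi * m / of_nat n) *
              lerch_phi (exp (\<i> * m * of_real pi / of_nat n)) (-k)
                (a * of_nat n - t / (2 * of_real pi) + 1)
            + exp (\<i> * m * t / of_nat n) *
              lerch_phi (exp (\<i> * m * of_real pi / of_nat n)) (-k)
                (a * of_nat n + t / (2 * of_real pi)))"
proof -
  define w where "w = exp (\<i> * m * of_real pi / of_nat n)"
  define z where "z = exp (\<i> * m * of_real pi)"
  define v1 where "v1 = a * of_nat n - t / (2 * of_real pi) + 1"
  define v2 where "v2 = a * of_nat n + t / (2 * of_real pi)"
  let ?\<Phi> = "\<lambda>v r. lerch_phi z (-k) ((v + of_nat r) / of_nat n)"
  have n0: "(of_nat n :: complex) \<noteq> 0" using assms(1) by simp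
  have w_power: "w ^ r = exp (\<i> * m * of_real pi * of_nat r / of_nat n)" for r
    by (simp add: w_def exp_of_nat_mult [symmetric] mult_ac)
  have wn: "w ^ n = z"
    using n0 by (simp add: w_power z_def)
  have m1: "(-1) powr m = w ^ n"
    by (simp add: wn z_def powr_def mult_ac)
  have "lerch_defined z (-k) (a - (2 * of_real pi * of_nat 0 + t) / (2 * of_nat n * of_real pi) + 1)"
    unfolding z_def by (rule assms(2)[OF assms(1)])
  hence z: "z \<notin> complex_of_real ` {1<..}" "z = 1 \<Longrightarrow> -k \<noteq> 1"
    unfolding lerch_defined_def by blast+
  have "of_nat n powr (-k) * of_nat n powr k = (1 :: complex)"
    using n0 by (simp add: powr_minus)
  hence mult: "of_nat n powr (-k) * lerch_phi w (-k) v = (\<Sum>r<n. w ^ r * ?\<Phi> v r)" for v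
    using lerch_phi_multiplication[OF assms(1), of w "-k" v] z
    by (simp add: wn mult.assoc [symmetric])

  \<comment> \<open>Here \<open>1 - r / n = (1 + (n - 1 - r)) / n\<close>, so the residues run backwards; the prefactor
    \<open>(-1) powr m = w ^ n\<close> supplies the powers of \<open>w\<close> that match the reversed order.\<close>
  have first: "exp (- (\<i> * of_real pi * m * of_nat r / of_nat n)) * ((-1) powr m *
        lerch_phi z (-k) (a - (2 * of_real pi * of_nat r + t) / (2 * of_nat n * of_real pi) + 1)) =
      w * (w ^ (n - Suc r) * ?\<Phi> v1 (n - Suc r))" if r: "r < n" for r
  proof -
    have "exp (- (\<i> * of_real pi * m * of_nat r / of_nat n)) * w ^ r = 1"
      by (simp add: w_power exp_minus mult_ac)
    moreover have "w ^ n = w ^ r * (w * w ^ (n - Suc r))"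
      using r by (metis Suc_diff_Suc add_diff_inverse_nat less_imp_not_less power_Suc power_add)
    ultimately have "exp (- (\<i> * of_real pi * m * of_nat r / of_nat n)) * (-1) powr m = w * w ^ (n - Suc r)"
      unfolding m1 by (simp add: mult.assoc [symmetric])
    moreover have "a - (2 * of_real pi * of_nat r + t) / (2 * of_nat n * of_real pi) + 1 =
                     (v1 + of_nat (n - Suc r)) / of_nat n"
      using r n0 by (simp add: v1_def of_nat_diff field_simps)
    ultimately show ?thesis by (simp add: mult.assoc [symmetric])
  qed
  have second: "exp (- (\<i> * of_real pi * m * of_nat r / of_nat n)) *
        (exp (\<i> * m * (2 * of_real pi * of_nat r + t) / of_nat n) *
        lerch_phi z (-k) (a + (2 * of_real pi * of_nat r + t) / (2 * of_nat n * of_real pi))) =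
      exp (\<i> * m * t / of_nat n) * (w ^ r * ?\<Phi> v2 r)" for r
  proof -
    have "exp (- (\<i> * of_real pi * m * of_nat r / of_nat n)) *
            exp (\<i> * m * (2 * of_real pi * of_nat r + t) / of_nat n) = exp (\<i> * m * t / of_nat n) * w ^ r"
      unfolding w_power exp_add [symmetric]
      by (rule arg_cong[of _ _ exp]) (use n0 in \<open>simp add: field_simps\<close>)
    moreover have "a + (2 * of_real pi * of_nat r + t) / (2 * of_nat n * of_real pi) =
                     (v2 + of_nat r) / of_nat n"
      using n0 by (simp add: v2_def field_simps)
    ultimately show ?thesis by (simp add: mult.assoc [symmetric])
  qed
  have "(\<Sum>r<n. exp (- (\<i> * of_real pi * m * of_nat r / of_nat n)) *
            ((-1) powr m *
               lerch_phi z (-k) (a - (2 * of_real pi * of_nat r + t) / (2 * of_nat n * of_real pi) + 1)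
             + exp (\<i> * m * (2 * of_real pi * of_nat r + t) / of_nat n) *
               lerch_phi z (-k) (a + (2 * of_real pi * of_nat r + t) / (2 * of_nat n * of_real pi)))) =
        (\<Sum>r<n. w * (w ^ (n - Suc r) * ?\<Phi> v1 (n - Suc r)) + exp (\<i> * m * t / of_nat n) * (w ^ r * ?\<Phi> v2 r))"
    by (intro sum.cong refl trans[OF distrib_left arg_cong2[where f = "(+)", OF first second]]) simp
  also have "\<dots> = w * (\<Sum>r<n. w ^ (n - Suc r) * ?\<Phi> v1 (n - Suc r)) +
                   exp (\<i> * m * t / of_nat n) * (\<Sum>r<n. w ^ r * ?\<Phi> v2 r)"
    by (simp only: sum.distrib sum_distrib_left)
  also have "(\<Sum>r<n. w ^ (n - Suc r) * ?\<Phi> v1 (n - Suc r)) = (\<Sum>r<n. w ^ r * ?\<Phi> v1 r)"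
    by (rule sum.nat_diff_reindex)
  also have "w * (\<Sum>r<n. w ^ r * ?\<Phi> v1 r) + exp (\<i> * m * t / of_nat n) * (\<Sum>r<n. w ^ r * ?\<Phi> v2 r) =
      of_nat n powr (-k) * (w * lerch_phi w (-k) v1 + exp (\<i> * m * t / of_nat n) * lerch_phi w (-k) v2)"
    by (simp add: mult [symmetric] algebra_simps)
  finally show ?thesis
    unfolding w_def z_def v1_def v2_def by (simp only: mult_ac)
qed

end
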